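(* Let $G=(V,E)$ be an undirected weighted $n$-vertex graph (positive weights), let $k\geq1$ be an integer and $\epsilon>0$. Then $G$ admits an interactive $(4+\epsilon)k$-emulator with size $O\left(k\cdot\frac{\log\Lambda}{\epsilon}\cdot n^{1+\frac{1}{k}}\right)$ and query time $O(\log\log k+\log\frac{1}{\epsilon})$, where $\Lambda=\frac{\max_{u,v}d_G(u,v)}{\min_{u\neq v}d_G(u,v)}$ is the aspect ratio of $G$.
   Context: An $\alpha$-emulator of $G$ is a weighted graph $H=(V,E',w')$ with $d_G(u,v)\leq d_H(u,v)\leq\alpha\, d_G(u,v)$ for all $u,v$. An interactive $\alpha$-emulator is a pair $(H,D)$ where $H$ is an $\alpha$-emulator and $D$ is an oracle that answers every query $(u,v)\in V^2$ with a $u$–$v$ path $P\subseteq E'$ with $d_G(u,v)\leq w'(P)\leq\alpha\, d_G(u,v)$. Size is $\max\{|E'|,|D|\}$ ($|D|$ in words); query time $q$ means time $O(q+|P|)$.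
   Formalization: In the size bound log Λ/ε is replaced by 1 + ln Λ/ε (with Λ = 1 every bound would be 0), and the query time log log k + log(1/ε) by 1 + ln(1 + ln k) + ln(1 + 1/ε) (undefined at k = 1, negative for large ε); G is taken connected. *)

theory Defs
  imports Complex_Main "Graph_Theory.Graph_Theory"
begin

section \<open>Weighted graphs and emulators\<close>

text \<open>
  A finite simple undirected graph is a symmetric loop-free \<open>pair_pre_digraph\<close>, the
  representation of undirected graphs in Graph_Theory: an edge is a pair of opposite arcs,
  and both arcs get the same weight.
\<close>

definition weighted_graph :: "'a pair_pre_digraph \<Rightarrow> ('a \<times> 'a) weight_fun \<Rightarrow> bool" where
  "weighted_graph G w \<longleftrightarrow>
     pair_graph G \<and> (\<forall>(x, y) \<in> parcs G. 0 < w (x, y) \<and> w (x, y) = w (y, x))"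

abbreviation gdist :: "'a pair_pre_digraph \<Rightarrow> ('a \<times> 'a) weight_fun \<Rightarrow> 'a \<Rightarrow> 'a \<Rightarrow> ereal" where
  "gdist G w u v \<equiv> wf_digraph.\<mu> (with_proj G) w u v"

definition edge_set :: "'a pair_pre_digraph \<Rightarrow> 'a set set" where
  "edge_set G = (\<lambda>(x, y). {x, y}) ` parcs G"

text \<open>The minimum over distinct vertices is undefined on a single vertex; there the ratio is 1.\<close>

definition aspect_ratio :: "'a pair_pre_digraph \<Rightarrow> ('a \<times> 'a) weight_fun \<Rightarrow> real" where
  "aspect_ratio G w =
     (if card (pverts G) \<le> 1 then 1
      else real_of_ereal
        (Max {gdist G w u v | u v. u \<in> pverts G \<and> v \<in> pverts G} /
         Min {gdist G w u v | u v. u \<in> pverts G \<and> v \<in> pverts G \<and> u \<noteq> v}))"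

definition emulator ::
  "real \<Rightarrow> 'a pair_pre_digraph \<Rightarrow> ('a \<times> 'a) weight_fun \<Rightarrow>
   'a pair_pre_digraph \<Rightarrow> ('a \<times> 'a) weight_fun \<Rightarrow> bool" where
  "emulator \<alpha> G w H w' \<longleftrightarrow>
     weighted_graph H w' \<and> pverts H = pverts G \<and>
     (\<forall>u \<in> pverts G. \<forall>v \<in> pverts G.
        gdist G w u v \<le> gdist H w' u v \<and> gdist H w' u v \<le> ereal \<alpha> * gdist G w u v)"


section \<open>The word RAM\<close>

text \<open>
  A unit-cost word RAM with word size \<open>W\<close>: every register and memory cell holds a natural
  number below \<open>2 ^ W\<close>, and arithmetic is modulo \<open>2 ^ W\<close>. A program is a finite list of
  instructions, so it uses a constant number of registers. Apart from memory it has a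
  write-only output tape. In \<open>Const\<close>, \<open>Op\<close> and \<open>Load\<close> the first register is the target;
  \<open>Load i j\<close> and \<open>Store i j\<close> access the memory cell whose address is in register \<open>j\<close>.
\<close>

datatype binop = Add | Sub | Mul | Div | Mod | And | Or | Xor | Shl | Shr

datatype instr =
    Const nat nat
  | Op binop nat nat nat
  | Load nat nat
  | Store nat nat
  | JumpLess nat nat nat
  | Output nat
  | Halt

type_synonym program = "instr list"

fun binop_val :: "nat \<Rightarrow> binop \<Rightarrow> nat \<Rightarrow> nat \<Rightarrow> nat" where
  "binop_val W Add a b = (a + b) mod 2 ^ W"
| "binop_val W Sub a b = (a + (2 ^ W - b)) mod 2 ^ W"
| "binop_val W Mul a b = (a * b) mod 2 ^ W"
| "binop_val W Div a b = a div b"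
| "binop_val W Mod a b = a mod b"
| "binop_val W And a b = Bit_Operations.and a b"
| "binop_val W Or a b = Bit_Operations.or a b"
| "binop_val W Xor a b = Bit_Operations.xor a b"
| "binop_val W Shl a b = (a * 2 ^ b) mod 2 ^ W"
| "binop_val W Shr a b = a div 2 ^ b"

record ram_state =
  pc :: nat
  regs :: "nat \<Rightarrow> nat"
  mem :: "nat \<Rightarrow> nat"
  outp :: "nat list"

fun exec_instr :: "nat \<Rightarrow> instr \<Rightarrow> ram_state \<Rightarrow> ram_state" where
  "exec_instr W (Const i c) s = s\<lparr>pc := Suc (pc s), regs := (regs s)(i := c mod 2 ^ W)\<rparr>"
| "exec_instr W (Op f i j l) s =
     s\<lparr>pc := Suc (pc s), regs := (regs s)(i := binop_val W f (regs s j) (regs s l))\<rparr>"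
| "exec_instr W (Load i j) s =
     s\<lparr>pc := Suc (pc s), regs := (regs s)(i := mem s (regs s j))\<rparr>"
| "exec_instr W (Store i j) s =
     s\<lparr>pc := Suc (pc s), mem := (mem s)(regs s j := regs s i)\<rparr>"
| "exec_instr W (JumpLess i j l) s =
     s\<lparr>pc := (if regs s i < regs s j then l else Suc (pc s))\<rparr>"
| "exec_instr W (Output i) s = s\<lparr>pc := Suc (pc s), outp := outp s @ [regs s i]\<rparr>"
| "exec_instr W Halt s = s"

definition halted :: "program \<Rightarrow> ram_state \<Rightarrow> bool" where
  "halted P s \<longleftrightarrow> length P \<le> pc s \<or> P ! pc s = Halt"

definition step :: "nat \<Rightarrow> program \<Rightarrow> ram_state \<Rightarrow> ram_state" where
  "step W P s = (if halted P s then s else exec_instr W (P ! pc s) s)"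


section \<open>Query oracles and interactive emulators\<close>

text \<open>
  The record below consists of a data structure, stored at the addresses \<open>0, 1, \<dots>\<close> (all
  other memory is initially zero), and a query program. Its size is the number of words of
  the data structure, and memory is reset to it for every query. The two vertices of a
  query are placed in the registers 0 and 1.
\<close>

record ram_oracle =
  query_prog :: program
  word_size :: nat
  stored :: "nat list"

definition oracle_init :: "ram_oracle \<Rightarrow> nat \<Rightarrow> nat \<Rightarrow> ram_state" where
  "oracle_init D u v =
     \<lparr>pc = 0,
      regs = (\<lambda>i. if i = 0 then u else if i = 1 then v else 0),
      mem = (\<lambda>a. if a < length (stored D) then stored D ! a else 0),
      outp = []\<rparr>"

definition answers_in :: "ram_oracle \<Rightarrow> nat \<Rightarrow> nat \<Rightarrow> nat list \<Rightarrow> nat \<Rightarrow> bool" where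
  "answers_in D u v xs t \<longleftrightarrow>
     (let s = (step (word_size D) (query_prog D) ^^ t) (oracle_init D u v)
      in halted (query_prog D) s \<and> outp s = xs)"

text \<open>
  Words have \<open>O(log (n + |D|))\<close> bits, enough to name a vertex and to address the data
  structure. Without the upper bound a single word could encode the whole graph.
\<close>

definition oracle_fits :: "real \<Rightarrow> nat \<Rightarrow> ram_oracle \<Rightarrow> bool" where
  "oracle_fits C n D \<longleftrightarrow>
     n \<le> 2 ^ word_size D \<and> length (stored D) \<le> 2 ^ word_size D \<and>
     (\<forall>x \<in> set (stored D). x < 2 ^ word_size D) \<and>
     real (word_size D) \<le> C * log 2 (real (n + length (stored D) + 2))"

text \<open>
  A query is answered by printing the vertices of a simple path of \<open>H\<close> in order; \<open>T l\<close>
  bounds the number of steps when the path has \<open>l\<close> edges.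
\<close>

definition interactive_emulator ::
  "real \<Rightarrow> nat pair_pre_digraph \<Rightarrow> (nat \<times> nat) weight_fun \<Rightarrow>
   nat pair_pre_digraph \<Rightarrow> (nat \<times> nat) weight_fun \<Rightarrow> ram_oracle \<Rightarrow> (nat \<Rightarrow> real) \<Rightarrow> bool" where
  "interactive_emulator \<alpha> G w H w' D T \<longleftrightarrow>
     emulator \<alpha> G w H w' \<and>
     (\<forall>u \<in> pverts G. \<forall>v \<in> pverts G. \<exists>p t.
        pre_digraph.apath (with_proj H) u p v \<and>
        gdist G w u v \<le> ereal (wf_digraph.awalk_cost w' p) \<and>
        ereal (wf_digraph.awalk_cost w' p) \<le> ereal \<alpha> * gdist G w u v \<and>
        answers_in D u v (pawalk_verts u p) t \<and> real t \<le> T (length p))"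

definition emulator_size :: "nat pair_pre_digraph \<Rightarrow> ram_oracle \<Rightarrow> nat" where
  "emulator_size H D = max (card (edge_set H)) (length (stored D))"

end

theory Submission
  imports Defs "HOL-Library.Discrete_Functions"
begin

text \<open>
  All edges of \<open>H\<close> carry exact distances of \<open>G\<close>, and every answer is a path \<open>u, c, v\<close> of at
  most two edges.

  For one scale \<open>r\<close>, region growing yields at most \<open>k n^(1/k)\<close> labellings of the vertices
  by cluster centres at distance at most \<open>2kr\<close> such that every \<open>r\<close>-ball is monochromatic in one
  of them. If \<open>c\<close> is the common label of \<open>u\<close> and \<open>v\<close> at the right scale among
  \<open>r = (1 + \<epsilon>/4)^i\<close>, then the path \<open>u, c, v\<close> has length at most \<open>4kr \<le> (4 + \<epsilon>) k d(u, v)\<close>.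
  As equality of labels is testable in constant time, the scale is found by binary search, for which
  an \<open>O(k)\<close>-approximation of \<open>d(u, v)\<close> must be known.

  The approximation comes from Ramsey-type linear orders: every vertex belongs to the good set of one
  of \<open>O(k n^(1/(2k)))\<close> orders, and if \<open>u\<close> is good and \<open>z\<close> lies between \<open>u\<close> and \<open>v\<close> in its order,
  then \<open>d(u, z)\<close> and \<open>d(z, v)\<close> are at most \<open>32 k d(u, v)\<close>. Between any two positions \<open>p\<close>, \<open>q\<close> there
  is a dyadic point determined by either of them and the leading bit of \<open>p xor q\<close>, so that a
  logarithmic number of precomputed words per vertex suffices. The logarithm is absorbed because
  \<open>ln n \<le> 2 k n^(1/(2k))\<close>. When \<open>\<epsilon>\<close> is large there is no room for the scales, but then this dyadic
  point itself is a good enough \<open>c\<close>.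
\<close>

section \<open>Sparse covers and Ramsey orders of finite metrics\<close>

text \<open>If each of the \<open>k\<close> steps grew by more than a factor \<open>q\<close>, the
  total growth would exceed \<open>q ^ k\<close>. This picks the cheap boundary ring in both
  decompositions below.\<close>

lemma ring_of_slow_growth:
  fixes c :: "nat \<Rightarrow> real"
  assumes "1 \<le> k" "0 \<le> q" "c k \<le> q ^ k * c 0"
  shows "\<exists>j<k. c (Suc j) \<le> q * c j"
proof (rule ccontr)
  assume "\<not> ?thesis"
  then have fast: "\<And>j. j < k \<Longrightarrow> q * c j < c (Suc j)" by force
  have "j < k \<Longrightarrow> q ^ Suc j * c 0 < c (Suc j)" for j
  proof (induction j)
    case 0 then show ?case using fast[of 0] by simp
  next
    case (Suc j)
    then have "q * (q ^ Suc j * c 0) \<le> q * c (Suc j)"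
      using assms(2) by (intro mult_left_mono) auto
    also have "\<dots> < c (Suc (Suc j))" using fast Suc.prems by simp
    finally show ?case by (simp add: mult.assoc)
  qed
  from this[of "k - 1"] show False using assms by simp
qed

text \<open>The derivative of \<open>k * s^(1/k)\<close> is \<open>s^(1/k) / s\<close>, so removing
  \<open>y >= s / s^(1/k)\<close> elements lowers it by at least 1. Bernoulli's inequality for
  \<open>(1 - 1/(k*a)) ^ k\<close> with \<open>a = root k s\<close> replaces the calculus.\<close>

lemma root_diff_le:
  assumes "1 \<le> k" "y \<le> s" "0 < s" "real s \<le> root k s * y"
  shows "real k * root k (real (s - y)) + 1 \<le> real k * root k s"
proof (rule ccontr)
  define a b where "a = root k s" and "b = root k (real (s - y))"
  assume "\<not> ?thesis"
  then have gt: "a - 1 / real k < b"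
    using assms(1) by (simp add: a_def b_def field_simps)
  have a1: "1 \<le> a" using assms by (simp add: a_def)
  have ak: "a ^ k = s" using assms by (simp add: a_def)
  have bk: "b ^ k = s - y" using assms by (simp add: b_def)
  have k1: "1 / real k \<le> 1" using assms(1) by simp
  have "- 1 \<le> - (1 / (real k * a))"
    using a1 assms(1) mult_mono[of 1 "real k" 1 a] by simp
  from Bernoulli_inequality[OF this, of k]
  have "1 - 1 / a \<le> (1 - 1 / (real k * a)) ^ k"
    using assms(1) a1 by simp
  then have "a ^ k * (1 - 1 / a) \<le> a ^ k * (1 - 1 / (real k * a)) ^ k"
    using a1 by (intro mult_left_mono) auto
  also have "\<dots> = (a - 1 / real k) ^ k"
    unfolding power_mult_distrib[symmetric] using a1 by (simp add: algebra_simps)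
  also have "\<dots> < b ^ k" using gt order_trans[OF k1 a1] assms(1) by (intro power_strict_mono) auto
  also have "\<dots> = s - y" by (rule bk)
  finally have "real s - s / a < real s - y" using assms(2) a1 by (simp add: ak algebra_simps of_nat_diff)
  then have "y * a < s" using a1 by (simp add: field_simps)
  then show False using assms(4) by (simp add: a_def mult.commute)
qed

text \<open>
  \<open>X (i + 1)\<close> is \<open>X i - Y i\<close>. So the \<open>Y i\<close> are disjoint, which bounds the sum, and the bound on
  \<open>T\<close> holds because \<open>k * root k (card (X i))\<close> drops by at least 1 in every round.
\<close>

lemma iterated_extraction:
  fixes V :: "'a set" and P :: "'a set \<Rightarrow> 'a set \<Rightarrow> bool"
  assumes "finite V" "1 \<le> k"
    and "\<And>X. X \<subseteq> V \<Longrightarrow> X \<noteq> {} \<Longrightarrow>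
      \<exists>Y\<subseteq>X. P X Y \<and> real (card X) \<le> root k (card X) * card Y"
  shows "\<exists>T X Y s. real T \<le> k * root k (card V) \<and>
    (\<Sum>i<T. real (card (X i))) \<le> root k (card V) * card V \<and>
    (\<forall>i<T. X i \<subseteq> V \<and> P (X i) (Y i)) \<and>
    (\<forall>u\<in>V. s u < T \<and> u \<in> Y (s u) \<and> (\<forall>i \<le> s u. u \<in> X i))"
  using assms
proof (induction "card V" arbitrary: V rule: less_induct)
  case less
  show ?case
  proof (cases "V = {}")
    case True
    then show ?thesis
      by (intro exI[of _ 0]) auto
  next
    case False
    then obtain Y0 where Y0: "Y0 \<subseteq> V" "P V Y0" "real (card V) \<le> root k (card V) * card Y0"
      using less.prems(3) by blast
    have cV: "0 < card V" using False less.prems by auto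
    have cY: "0 < card Y0" using Y0(3) cV by (cases "card Y0") auto
    have cd: "card (V - Y0) = card V - card Y0"
      using Y0 less.prems(1) by (simp add: card_Diff_subset finite_subset)
    have leq: "card Y0 \<le> card V" using Y0 less.prems(1) by (simp add: card_mono)
    have lt: "card (V - Y0) < card V" using cd cY cV by simp
    have "\<exists>T X Y s. real T \<le> k * root k (card (V - Y0)) \<and>
      (\<Sum>i<T. real (card (X i))) \<le> root k (card (V - Y0)) * card (V - Y0) \<and>
      (\<forall>i<T. X i \<subseteq> V - Y0 \<and> P (X i) (Y i)) \<and>
      (\<forall>u\<in>V - Y0. s u < T \<and> u \<in> Y (s u) \<and> (\<forall>i \<le> s u. u \<in> X i))"
      using less.prems by (intro less.hyps lt) auto
    then obtain T X Y s where IH: "real T \<le> k * root k (card (V - Y0))"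
      "(\<Sum>i<T. real (card (X i))) \<le> root k (card (V - Y0)) * card (V - Y0)"
      "\<And>i. i < T \<Longrightarrow> X i \<subseteq> V - Y0 \<and> P (X i) (Y i)"
      "\<And>u. u \<in> V - Y0 \<Longrightarrow> s u < T \<and> u \<in> Y (s u) \<and> (\<forall>i \<le> s u. u \<in> X i)"
      by blast
    \<comment> \<open>The extraction from \<open>V\<close> becomes round 0, and the rounds on
      \<open>V - Y0\<close> shift up by one.\<close>
    let ?X = "case_nat V X" and ?Y = "case_nat Y0 Y"
    let ?s = "\<lambda>u. if u \<in> Y0 then 0 else Suc (s u)"
    have "real (Suc T) \<le> k * root k (card V)"
      using IH(1) root_diff_le[OF less.prems(2) leq cV Y0(3)] by (simp add: cd)
    moreover have "(\<Sum>i<Suc T. real (card (?X i))) \<le> root k (card V) * card V"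
    proof -
      have "(\<Sum>i<Suc T. real (card (?X i))) = card V + (\<Sum>i<T. real (card (X i)))"
        unfolding sum.lessThan_Suc_shift by simp
      also have "\<dots> \<le> root k (card V) * card Y0 + root k (card (V - Y0)) * card (V - Y0)"
        using Y0(3) IH(2) by simp
      also have "\<dots> \<le> root k (card V) * card Y0 + root k (card V) * card (V - Y0)"
        using cd less.prems(2) by (intro add_left_mono mult_right_mono) auto
      also have "\<dots> = root k (card V) * card V"
        using leq by (simp add: cd algebra_simps of_nat_diff)
      finally show ?thesis .
    qed
    moreover have "\<forall>i<Suc T. ?X i \<subseteq> V \<and> P (?X i) (?Y i)"
      using IH(3) Y0 by (auto split: nat.split)
    moreover have "\<forall>u\<in>V. ?s u < Suc T \<and> u \<in> ?Y (?s u) \<and> (\<forall>i \<le> ?s u. u \<in> ?X i)"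
      using IH(4) by (auto split: nat.split)
    ultimately show ?thesis
      by (intro exI[of _ "Suc T"] exI[of _ ?X] exI[of _ ?Y] exI[of _ ?s] conjI)
  qed
qed

section \<open>Sparse covers\<close>

locale finite_metric =
  fixes V :: "'a set" and d :: "'a \<Rightarrow> 'a \<Rightarrow> real"
  assumes finite_V: "finite V"
    and d_self: "x \<in> V \<Longrightarrow> d x x = 0"
    and d_pos: "x \<in> V \<Longrightarrow> y \<in> V \<Longrightarrow> x \<noteq> y \<Longrightarrow> 0 < d x y"
    and d_sym: "x \<in> V \<Longrightarrow> y \<in> V \<Longrightarrow> d x y = d y x"
    and d_triangle: "x \<in> V \<Longrightarrow> y \<in> V \<Longrightarrow> z \<in> V \<Longrightarrow> d x z \<le> d x y + d y z"
begin

lemma d_nonneg: "x \<in> V \<Longrightarrow> y \<in> V \<Longrightarrow> 0 \<le> d x y"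
  using d_self d_pos[of x y] by (cases "x = y") auto

text \<open>A family of disjoint clusters is encoded by sending each vertex to its centre, so that a
  query tests membership in a common cluster by comparing two labels. \<open>Y\<close> is the set of
  padded vertices.\<close>

definition covering_labels :: "nat \<Rightarrow> real \<Rightarrow> ('a \<Rightarrow> 'a) \<Rightarrow> 'a set \<Rightarrow> bool" where
  "covering_labels k r lab Y \<longleftrightarrow>
     (\<forall>x\<in>V. lab x \<in> V \<and> d x (lab x) \<le> 2 * real k * r) \<and>
     (\<forall>u\<in>Y. \<forall>v\<in>V. d u v \<le> r \<longrightarrow> lab v = lab u)"

text \<open>
  A cluster consists of the \<open>r\<close>-balls around the part of \<open>S\<close> within \<open>2jr\<close> of a vertex \<open>v\<close>; the part of
  \<open>S\<close> in the next ring is given up, which separates the cluster from the balls treated later.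
\<close>

lemma covering_labels_aux:
  assumes "S \<subseteq> V" "1 \<le> k" "0 \<le> r" "0 \<le> q" "real (card S) \<le> q ^ k"
  shows "\<exists>lab. \<exists>Y\<subseteq>S. covering_labels k r lab Y \<and> real (card S) \<le> q * card Y"
  using assms
proof (induction "card S" arbitrary: S rule: less_induct)
  case less
  have fS: "finite S" using less.prems(1) finite_V finite_subset by blast
  show ?case
  proof (cases "S = {}")
    case True
    then show ?thesis
      using less.prems by (intro exI[of _ "\<lambda>x. x"]) (auto simp: covering_labels_def d_self)
  next
    case False
    then obtain v where v: "v \<in> S" by blast
    \<comment> \<open>A ring has width \<open>2 * r\<close>: one \<open>r\<close> for the balls
      around the inner part and one for the balls around what remains outside.\<close>
    define Z where "Z j = {u \<in> S. d u v \<le> 2 * real j * r}" for j :: nat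
    have fZ: "finite (Z j)" for j using fS by (simp add: Z_def)
    have "{v} \<subseteq> Z 0" using v less.prems(1) by (auto simp: Z_def d_self)
    then have Z0: "1 \<le> card (Z 0)" using fZ card_mono[of "Z 0" "{v}"] by simp
    have "real (card (Z k)) \<le> card S" using fS by (auto simp: Z_def intro: card_mono)
    also have "\<dots> \<le> q ^ k * 1" using less.prems by simp
    also have "\<dots> \<le> q ^ k * card (Z 0)" using Z0 less.prems(4) by (intro mult_left_mono) auto
    finally obtain j where j: "j < k" "card (Z (Suc j)) \<le> q * card (Z j)"
      using ring_of_slow_growth[of k q "\<lambda>j. card (Z j)"] less.prems by auto
    let ?S = "S - Z (Suc j)"
    have sub: "Z j \<subseteq> Z (Suc j)"
      using \<open>0 \<le> r\<close> by (auto simp: Z_def algebra_simps intro: order_trans)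
    then have vZ: "v \<in> Z (Suc j)" using v less.prems \<open>0 \<le> r\<close> by (simp add: Z_def d_self subset_iff)
    have lt: "card ?S < card S" using v vZ fS by (intro psubset_card_mono) auto
    have "real (card ?S) \<le> q ^ k" using lt less.prems(5) by linarith
    from less.hyps[OF lt _ less.prems(2-4) this] less.prems(1)
    obtain lab Y where IH: "Y \<subseteq> ?S" "covering_labels k r lab Y" "real (card ?S) \<le> q * card Y"
      by auto
    \<comment> \<open>The new cluster stays within \<open>(2 * j + 1) * r\<close> of
      \<open>v\<close>, whereas the \<open>r\<close>-balls around points of \<open>Y\<close> stay
      outside that radius. So overwriting \<open>lab\<close> on \<open>B\<close> does not disturb
      them.\<close>
    define B where "B = {x \<in> V. \<exists>u\<in>Z j. d u x \<le> r}"
    define lab' where "lab' x = (if x \<in> B then v else lab x)" for x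
    have vV: "v \<in> V" and YV: "Y \<subseteq> V" using v IH(1) less.prems(1) by auto
    have "d x v \<le> 2 * real k * r" if x: "x \<in> B" for x
    proof -
      obtain u where u: "u \<in> S" "d u v \<le> 2 * real j * r" "d u x \<le> r" "x \<in> V"
        using x by (auto simp: B_def Z_def)
      have "d x v \<le> d x u + d u v" using d_triangle u vV less.prems(1) by blast
      also have "\<dots> \<le> (2 * real j + 1) * r" using u d_sym[of x u] less.prems(1) by (auto simp: algebra_simps)
      also have "\<dots> \<le> (2 * real k) * r" using j(1) \<open>0 \<le> r\<close> by (intro mult_right_mono) auto
      finally show ?thesis .
    qed
    moreover have "x \<notin> B" if "u \<in> Y" "x \<in> V" "d u x \<le> r" for u x
    proof
      assume "x \<in> B"
      then obtain z where z: "z \<in> S" "d z v \<le> 2 * real j * r" "d z x \<le> r"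
        by (auto simp: B_def Z_def)
      have uS: "u \<in> S" "u \<notin> Z (Suc j)" using that IH(1) by auto
      have V: "u \<in> V" "z \<in> V" using uS z less.prems(1) by auto
      have "d u v \<le> d u x + (d x z + d z v)"
        using d_triangle[of u x v] d_triangle[of x z v] V vV that by fastforce
      also have "\<dots> \<le> 2 * real (Suc j) * r"
        using that z d_sym[of x z] V by (simp add: algebra_simps)
      finally show False using uS by (simp add: Z_def)
    qed
    moreover have "Z j \<subseteq> V" using less.prems(1) by (auto simp: Z_def)
    moreover have "x \<in> B" if "u \<in> Z j" "x \<in> V" "d u x \<le> r" for u x
      using that by (auto simp: B_def)
    moreover have "u \<in> B" if "u \<in> Z j" for u
      using that less.prems(1) \<open>0 \<le> r\<close> by (auto simp: B_def intro!: bexI[of _ u]) (auto simp: Z_def d_self subset_iff)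
    moreover have "u \<notin> B" if "u \<in> Y" for u
      using that calculation(2)[of u u] YV \<open>0 \<le> r\<close> by (auto simp: d_self)
    ultimately have "covering_labels k r lab' (Z j \<union> Y)"
      using IH(2) vV unfolding covering_labels_def lab'_def by auto
    moreover have "real (card S) \<le> q * card (Z j \<union> Y)"
    proof -
      have "card S = card (Z (Suc j)) + card ?S"
        using fS card_mono[OF fS, of "Z (Suc j)"]
        by (subst card_Diff_subset) (auto simp: Z_def)
      then have "real (card S) \<le> q * (card (Z j) + card Y)"
        using j(2) IH(3) by (simp add: algebra_simps)
      moreover have "card (Z j \<union> Y) = card (Z j) + card Y"
        using IH(1) sub fZ fS finite_subset[OF IH(1)] by (intro card_Un_disjoint) auto
      ultimately show ?thesis by simp
    qed
    moreover have "Z j \<union> Y \<subseteq> S" using IH(1) by (auto simp: Z_def)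
    ultimately show ?thesis by blast
  qed
qed

text \<open>With \<open>q = root k (card X)\<close> a single labelling pads at least the fraction
  \<open>1 / q\<close> of the vertices still unpadded, which is what
  \<open>iterated_extraction\<close> needs. \<open>s u\<close> is the round that pads
  \<open>u\<close>.\<close>

lemma covering_labels_exist:
  assumes "1 \<le> k" "0 \<le> r"
  shows "\<exists>T lab s. real T \<le> k * root k (card V) \<and>
    (\<forall>j<T. \<forall>x\<in>V. lab j x \<in> V \<and> d x (lab j x) \<le> 2 * real k * r) \<and>
    (\<forall>u\<in>V. s u < (T::nat) \<and> (\<forall>v\<in>V. d u v \<le> r \<longrightarrow> lab (s u) v = lab (s u) u))"
proof -
  have "\<exists>Y\<subseteq>X. (\<exists>lab. covering_labels k r lab Y) \<and> real (card X) \<le> root k (card X) * card Y"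
    if "X \<subseteq> V" "X \<noteq> {}" for X
    using covering_labels_aux[of X k r "root k (card X)"] that assms by auto
  from iterated_extraction[OF finite_V assms(1) this]
  obtain T X Y s where T: "real T \<le> k * root k (card V)"
    "\<forall>i<T. \<exists>lab. covering_labels k r lab (Y i)" "\<forall>u\<in>V. s u < T \<and> u \<in> Y (s u)"
    by (metis (no_types, lifting))
  then obtain lab where "\<forall>i<T. covering_labels k r (lab i) (Y i)" by metis
  with T show ?thesis
    unfolding covering_labels_def by (intro exI[of _ T] exI[of _ lab] exI[of _ s]) blast
qed

section \<open>Ramsey-type linear orders\<close>

text \<open>Of a hierarchical decomposition only the order of its leaves is kept; an intermediate
  position then plays the part of a common ancestor.\<close>

definition ramsey_order :: "real \<Rightarrow> 'a list \<Rightarrow> 'a set \<Rightarrow> bool" where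
  "ramsey_order c xs U \<longleftrightarrow>
     (\<forall>i j l. i \<le> j \<and> j \<le> l \<and> l < length xs \<and> (xs ! i \<in> U \<or> xs ! l \<in> U) \<longrightarrow>
        d (xs ! i) (xs ! j) \<le> c * d (xs ! i) (xs ! l) \<and>
        d (xs ! j) (xs ! l) \<le> c * d (xs ! i) (xs ! l))"

text \<open>A triple inside one half inherits the property. If its ends lie in different halves, the
  separation bounds \<open>D\<close> by \<open>c\<close> times their distance, and no distance
  exceeds \<open>D\<close>.\<close>

lemma ramsey_order_append:
  assumes "ramsey_order c xs U" "ramsey_order c ys W"
    and "U \<inter> set ys = {}" "W \<inter> set xs = {}" "U \<subseteq> set xs" "W \<subseteq> set ys"
    and D: "\<And>x y. x \<in> set xs \<union> set ys \<Longrightarrow> y \<in> set xs \<union> set ys \<Longrightarrow> d x y \<le> D"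
    and sep: "\<And>x y. x \<in> set xs \<Longrightarrow> y \<in> set ys \<Longrightarrow> x \<in> U \<or> y \<in> W \<Longrightarrow> D \<le> c * d x y"
  shows "ramsey_order c (xs @ ys) (U \<union> W)"
  unfolding ramsey_order_def
proof (intro allI impI, elim conjE)
  fix i j l assume ijl: "i \<le> j" "j \<le> l" "l < length (xs @ ys)"
    and UW: "(xs @ ys) ! i \<in> U \<union> W \<or> (xs @ ys) ! l \<in> U \<union> W"
  let ?z = "\<lambda>i. (xs @ ys) ! i"
  have mem: "?z i \<in> set (xs @ ys)" "?z j \<in> set (xs @ ys)" "?z l \<in> set (xs @ ys)"
    using ijl by (auto intro!: nth_mem simp del: set_append)
  consider "l < length xs" | "length xs \<le> i" | "i < length xs" "length xs \<le> l" by linarith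
  then show "d (?z i) (?z j) \<le> c * d (?z i) (?z l) \<and> d (?z j) (?z l) \<le> c * d (?z i) (?z l)"
  proof cases
    case 1
    then have "xs ! i \<in> U \<or> xs ! l \<in> U"
      using UW assms(4) ijl by (auto simp: nth_append disjoint_iff)
    then show ?thesis
      using 1 assms(1) ijl unfolding ramsey_order_def by (simp add: nth_append)
  next
    case 2
    let ?f = "\<lambda>i. i - length xs"
    have "ys ! ?f i \<in> W \<or> ys ! ?f l \<in> W"
      using 2 UW assms(3) ijl by (auto simp: nth_append disjoint_iff)
    moreover have "?f i \<le> ?f j" "?f j \<le> ?f l" "?f l < length ys" using 2 ijl by auto
    ultimately have "d (ys ! ?f i) (ys ! ?f j) \<le> c * d (ys ! ?f i) (ys ! ?f l) \<and>
        d (ys ! ?f j) (ys ! ?f l) \<le> c * d (ys ! ?f i) (ys ! ?f l)"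
      using assms(2) unfolding ramsey_order_def by blast
    then show ?thesis using 2 ijl by (simp add: nth_append)
  next
    case 3
    have "?z i \<in> set xs" "?z l \<in> set ys" using 3 ijl by (auto simp: nth_append)
    moreover have "?z i \<in> U \<or> ?z l \<in> W"
      using UW calculation assms(3-6) by blast
    ultimately have "D \<le> c * d (?z i) (?z l)" using sep by blast
    moreover have "d (?z i) (?z j) \<le> D" "d (?z j) (?z l) \<le> D" using D mem by auto
    ultimately show ?thesis by linarith
  qed
qed

text \<open>
  Let \<open>D\<close> be the diameter. Split off a ball around the vertex \<open>v\<close> whose ball of
  radius \<open>D/8\<close> contains the largest number \<open>m\<close> of points of \<open>S\<close>, and
  give up the ring of \<open>S\<close> at its boundary. The inner part has at most half the diameter, so by
  the choice of \<open>v\<close> its own \<open>M\<close> is at most \<open>m\<close>; the loss of a factor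
  \<open>root k (M / m)\<close> at the boundary therefore telescopes over the levels.
\<close>

lemma ramsey_order_aux:
  assumes "X \<subseteq> V" "X \<noteq> {}" "S \<subseteq> X" "1 \<le> k" "0 \<le> M"
    and "\<And>x y. x \<in> X \<Longrightarrow> y \<in> X \<Longrightarrow> d x y \<le> D"
    and "\<And>x. x \<in> X \<Longrightarrow> real (card {y \<in> S. d y x \<le> D / 4}) \<le> M"
  shows "\<exists>xs. \<exists>U\<subseteq>S. distinct xs \<and> set xs = X \<and> real (card S) \<le> root k M * card U \<and>
    ramsey_order (16 * real k) xs U"
  using assms
proof (induction "card X" arbitrary: X S M D rule: less_induct)
  case less
  have fX: "finite X" using less.prems(1) finite_V finite_subset by blast
  have fS: "finite S" using less.prems(3) fX finite_subset by blast
  show ?case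
  proof (cases "\<exists>a. X = {a}")
    case True
    then obtain a where a: "X = {a}" by blast
    have aV: "a \<in> V" and daa: "d a a = 0" using a less.prems(1) d_self by auto
    \<comment> \<open>For a single vertex the hypothesis on balls gives
      \<open>card S \<le> M\<close>; as \<open>card S\<close> is 0 or 1, the root may then be
      taken.\<close>
    have "0 \<le> D" using less.prems(6)[of a a] a daa by simp
    then have "{y \<in> S. d y a \<le> D / 4} = S" using less.prems(3) a daa by auto
    then have SM: "real (card S) \<le> M" using less.prems(7)[of a] a by simp
    have cS: "card S \<le> 1" using less.prems(3) a card_mono[of "{a}" S] by simp
    have "real (card S) \<le> root k M * card S"
    proof (cases "card S = 0")
      case False
      then have "card S = 1" using cS by simp
      then show ?thesis using SM less.prems(4) by simp
    qed simp
    moreover have "ramsey_order (16 * real k) [a] S"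
      by (auto simp: ramsey_order_def daa)
    ultimately show ?thesis using a by (intro exI[of _ "[a]"] exI[of _ S]) auto
  next
    case False
    obtain a b where ab: "a \<in> X" "b \<in> X" "a \<noteq> b" using False less.prems(2) by blast
    \<comment> \<open>\<open>D\<close> is only an upper bound. The exact diameter \<open>D'\<close>
      is needed to make \<open>A\<close> a proper subset, since it cannot contain both ends of a
      diameter.\<close>
    define D' where "D' = Max ((\<lambda>(x, y). d x y) ` (X \<times> X))"
    have D'_ge: "d x y \<le> D'" if "x \<in> X" "y \<in> X" for x y
      unfolding D'_def using fX that by (intro Max_ge) (auto intro: rev_image_eqI[of "(x,y)"])
    have "D' \<in> (\<lambda>(x, y). d x y) ` (X \<times> X)"
      unfolding D'_def using fX less.prems(2) by (intro Max_in) auto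
    then obtain a' b' where a'b': "a' \<in> X" "b' \<in> X" "d a' b' = D'" by auto
    have "0 < d a b" using d_pos ab less.prems(1) by blast
    then have D'_pos: "0 < D'" using D'_ge[OF ab(1,2)] by linarith
    have D'_le: "D' \<le> D" using less.prems(6) a'b' by metis
    define f where "f x = card {y \<in> S. d y x \<le> D' / 8}" for x
    obtain v where v: "v \<in> X" "\<And>x. x \<in> X \<Longrightarrow> f x \<le> f v"
    proof -
      have "Max (f ` X) \<in> f ` X" using fX less.prems(2) by (intro Max_in) auto
      then obtain v where "v \<in> X" "f v = Max (f ` X)" by auto
      then show ?thesis using that fX by (metis Max_ge finite_imageI imageI)
    qed
    define m where "m = f v"
    \<comment> \<open>The radii run from \<open>D' / 8\<close>, where \<open>v\<close> is optimal,
      to \<open>D' / 4\<close>, where the hypothesis on \<open>M\<close> applies.\<close>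
    define \<rho> where "\<rho> j = D' / 8 + real j * (D' / (8 * k))" for j :: nat
    define c where "c j = card {y \<in> S. d y v \<le> \<rho> j}" for j
    define q where "q = root k (M / m)"
    have k0: "0 < k" using less.prems(4) by simp
    have "\<rho> k = D' / 4" using k0 by (simp add: \<rho>_def field_simps)
    then have "{y \<in> S. d y v \<le> \<rho> k} \<subseteq> {y \<in> S. d y v \<le> D / 4}" using D'_le by auto
    then have "c k \<le> card {y \<in> S. d y v \<le> D / 4}"
      unfolding c_def using fS by (intro card_mono) auto
    then have ckM: "real (c k) \<le> M" using less.prems(7)[OF v(1)] by linarith
    have c0: "c 0 = m" by (simp add: c_def m_def f_def \<rho>_def)
    have Spos: "0 < m" if "x \<in> S" for x
    proof -
      have "x \<in> {y \<in> S. d y x \<le> D' / 8}"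
        using that less.prems(1,3) D'_pos d_self by auto
      then have "0 < f x" unfolding f_def using fS by (auto simp: card_gt_0_iff)
      then show ?thesis using v(2)[of x] that less.prems(3) by (auto simp: m_def)
    qed
    have q0: "0 \<le> q" using less.prems(5) k0 by (simp add: q_def)
    have qk: "q ^ k = M / m" using k0 less.prems(5) by (simp add: q_def)
    \<comment> \<open>For \<open>m = 0\<close> division by zero makes \<open>q\<close> zero, but
      then \<open>S\<close> is empty and all counts vanish.\<close>
    have "real (c k) \<le> q ^ k * c 0"
    proof (cases "m = 0")
      case True
      then have "S = {}" using Spos by auto
      then show ?thesis by (simp add: c_def)
    next
      case False then show ?thesis using ckM by (simp add: qk c0)
    qed
    from ring_of_slow_growth[of k q "\<lambda>j. c j", OF less.prems(4) q0 this]
    obtain j where j: "j < k" "real (c (Suc j)) \<le> q * c j" by auto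
    \<comment> \<open>The cut runs through the middle of the ring, which leaves
      \<open>D' / (16 * k)\<close> on either side; this is the source of the constant 16.\<close>
    define A where "A = {x \<in> X. d x v \<le> \<rho> j + D' / (16 * k)}"
    define S1 where "S1 = {y \<in> S. d y v \<le> \<rho> j}"
    define S2 where "S2 = {y \<in> S. \<rho> (Suc j) < d y v}"
    have step: "\<rho> (Suc j) = \<rho> j + D' / (16 * k) + D' / (16 * k)"
      using k0 by (simp add: \<rho>_def field_simps)
    have pos16: "0 < D' / (16 * k)" using D'_pos k0 by simp
    have "\<rho> (Suc j) \<le> \<rho> k"
      unfolding \<rho>_def using j(1) D'_pos by (intro add_left_mono mult_right_mono) auto
    then have \<rho>A: "\<rho> j + D' / (16 * k) < D' / 4"
      using step pos16 \<open>\<rho> k = D' / 4\<close> by linarith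
    have XV: "\<And>x. x \<in> X \<Longrightarrow> x \<in> V" using less.prems(1) by blast
    have diamA: "d x y \<le> D' / 2" "d x y < D'" if "x \<in> A" "y \<in> A" for x y
    proof -
      have "d x y \<le> d x v + d v y" using d_triangle XV v that by (auto simp: A_def)
      also have "\<dots> = d x v + d y v" using d_sym XV v that by (auto simp: A_def)
      also have "\<dots> < D' / 4 + D' / 4" using that \<rho>A by (auto simp: A_def)
      finally show "d x y \<le> D' / 2" "d x y < D'" using D'_pos by auto
    qed
    have AX: "A \<subset> X"
    proof -
      have "\<not> (a' \<in> A \<and> b' \<in> A)" using diamA(2) a'b'(3) by force
      then show ?thesis using a'b' by (auto simp: A_def)
    qed
    have "0 \<le> \<rho> j" using D'_pos by (simp add: \<rho>_def)
    then have vA: "v \<in> A" using v(1) XV d_self pos16 by (auto simp: A_def)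
    have S1A: "S1 \<subseteq> A" using less.prems(3) pos16 by (auto simp: S1_def A_def)
    have S2A: "S2 \<subseteq> X - A" using less.prems(3) pos16 step by (auto simp: S2_def A_def)
    \<comment> \<open>The bound for \<open>A\<close> is \<open>D' / 2\<close>, so the relevant balls
      have radius \<open>D' / 8\<close> and contain at most \<open>m\<close> points by the choice of
      \<open>v\<close>.\<close>
    have "\<exists>xs. \<exists>U\<subseteq>S1. distinct xs \<and> set xs = A \<and> real (card S1) \<le> root k m * card U \<and>
        ramsey_order (16 * real k) xs U"
    proof (rule less.hyps[where D = "D' / 2"])
      show "card A < card X" using AX fX by (intro psubset_card_mono) auto
      fix x assume "x \<in> A"
      then have "x \<in> X" by (simp add: A_def)
      have "card {y \<in> S1. d y x \<le> D' / 2 / 4} \<le> f x"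
        unfolding f_def using fS by (intro card_mono) (auto simp: S1_def)
      then show "real (card {y \<in> S1. d y x \<le> D' / 2 / 4}) \<le> real m"
        using v(2)[OF \<open>x \<in> X\<close>] by (simp add: m_def)
    qed (use AX vA S1A diamA less.prems(1,4) in auto)
    then obtain xs U where xs: "U \<subseteq> S1" "distinct xs" "set xs = A"
      "real (card S1) \<le> root k m * card U" "ramsey_order (16 * real k) xs U" by blast
    have "\<exists>ys. \<exists>W\<subseteq>S2. distinct ys \<and> set ys = X - A \<and> real (card S2) \<le> root k M * card W \<and>
        ramsey_order (16 * real k) ys W"
    proof (rule less.hyps[where D = D'])
      show "card (X - A) < card X" using vA v fX by (intro psubset_card_mono) auto
      fix x assume x: "x \<in> X - A"
      have "card {y \<in> S2. d y x \<le> D' / 4} \<le> card {y \<in> S. d y x \<le> D / 4}"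
        using fS D'_le by (intro card_mono) (auto simp: S2_def)
      then show "real (card {y \<in> S2. d y x \<le> D' / 4}) \<le> M"
        using less.prems(7)[of x] x by simp
    qed (use AX S2A D'_ge less.prems(1,4,5) in auto)
    then obtain ys W where ys: "W \<subseteq> S2" "distinct ys" "set ys = X - A"
      "real (card S2) \<le> root k M * card W" "ramsey_order (16 * real k) ys W" by blast
    have "ramsey_order (16 * real k) (xs @ ys) (U \<union> W)"
    proof (rule ramsey_order_append[where D = D'])
      fix x y assume "x \<in> set xs \<union> set ys" "y \<in> set xs \<union> set ys"
      then show "d x y \<le> D'" using D'_ge xs(3) ys(3) AX by auto
    next
      fix x y assume x: "x \<in> set xs" and y: "y \<in> set ys" and UW: "x \<in> U \<or> y \<in> W"
      have V: "x \<in> V" "y \<in> V" "v \<in> V" using x y xs(3) ys(3) XV v AX by auto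
      have xA: "d x v \<le> \<rho> j + D' / (16 * k)" and yA: "\<rho> j + D' / (16 * k) < d y v"
        using x y xs(3) ys(3) by (auto simp: A_def)
      have "d x v \<le> \<rho> j \<or> \<rho> (Suc j) < d y v"
        using UW xs(1) ys(1) by (auto simp: S1_def S2_def)
      then have "D' / (16 * k) \<le> d y v - d x v"
        using xA yA step by linarith
      also have "\<dots> \<le> d x y" using d_triangle[of y x v] d_sym[of x y] V by simp
      finally show "D' \<le> 16 * real k * d x y" using k0 by (simp add: field_simps)
    qed (use xs ys S1A S2A in auto)
    moreover have "distinct (xs @ ys)" "set (xs @ ys) = X"
      using xs ys AX by auto
    moreover have UW: "U \<union> W \<subseteq> S" using xs(1) ys(1) by (auto simp: S1_def S2_def)
    moreover have "real (card S) \<le> root k M * card (U \<union> W)"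
    proof -
      have fUW: "finite U" "finite W" using UW fS finite_subset by auto
      have "S = {y \<in> S. d y v \<le> \<rho> (Suc j)} \<union> S2" by (auto simp: S2_def)
      then have "card S \<le> c (Suc j) + card S2" unfolding c_def by (metis card_Un_le)
      then have "real (card S) \<le> q * card S1 + card S2"
        using j(2) by (simp add: c_def S1_def)
      also have "q * card S1 \<le> root k M * card U"
      proof (cases "m = 0")
        case True
        then have "S = {}" using Spos by auto
        then show ?thesis using less.prems(5) k0 by (simp add: S1_def)
      next
        case False
        \<comment> \<open>Telescoping: the boundary loss \<open>root k (M / m)\<close> times the
          recursive loss \<open>root k m\<close> is \<open>root k M\<close>.\<close>
        have "q * card S1 \<le> q * (root k m * card U)" using xs(4) q0 by (rule mult_left_mono)
        also have "\<dots> = root k M * card U"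
          using False k0 by (simp add: q_def real_root_mult[symmetric])
        finally show ?thesis .
      qed
      also have "real (card S2) \<le> root k M * card W" by (rule ys(4))
      also have "root k M * card U + root k M * card W = root k M * card (U \<union> W)"
        using fUW xs(1) ys(1) S1A S2A by (subst card_Un_disjoint) (auto simp: algebra_simps)
      finally show ?thesis by simp
    qed
    ultimately show ?thesis by blast
  qed
qed

text \<open>As \<open>u\<close> occurs in every order up to \<open>s u\<close>, the order
  \<open>min (s u) (s v)\<close> contains both vertices, and one of them is good in it. Bounding the
  sum of the lengths instead of \<open>T * card V\<close> saves a factor of order \<open>k\<close>
  once every position carries logarithmically many entries.\<close>

lemma ramsey_orders_exist:
  assumes "1 \<le> k"
  shows "\<exists>T xs s. real T \<le> k * root k (card V) \<and>
    (\<Sum>i<T. real (length (xs i))) \<le> root k (card V) * card V \<and>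
    (\<forall>i<T. distinct (xs i) \<and> set (xs i) \<subseteq> V) \<and>
    (\<forall>u\<in>V. s u < (T::nat) \<and> (\<forall>i \<le> s u. u \<in> set (xs i))) \<and>
    (\<forall>u\<in>V. \<exists>U. u \<in> U \<and> ramsey_order (16 * real k) (xs (s u)) U)"
proof -
  let ?P = "\<lambda>X U. \<exists>xs. distinct xs \<and> set xs = X \<and> ramsey_order (16 * real k) xs U"
  have "\<exists>Y\<subseteq>X. ?P X Y \<and> real (card X) \<le> root k (card X) * card Y"
    if X: "X \<subseteq> V" "X \<noteq> {}" for X
  proof -
    have fX: "finite X" using X finite_V finite_subset by blast
    \<comment> \<open>The sum of all distances is a crude bound on the diameter, which suffices
      because \<open>M = card X\<close> bounds every count.\<close>
    define D where "D = (\<Sum>x\<in>X. \<Sum>y\<in>X. d x y)"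
    have "d x y \<le> D" if "x \<in> X" "y \<in> X" for x y
    proof -
      have "d x y \<le> (\<Sum>y\<in>X. d x y)"
        using that X fX d_nonneg by (intro member_le_sum) auto
      also have "\<dots> \<le> D"
        unfolding D_def using that X fX d_nonneg
        by (intro member_le_sum[where f = "\<lambda>x. \<Sum>y\<in>X. d x y"]) (auto intro!: sum_nonneg)
      finally show ?thesis .
    qed
    moreover have "real (card {y \<in> X. d y x \<le> D / 4}) \<le> card X" for x
      using fX by (auto intro: card_mono)
    ultimately show ?thesis
      using ramsey_order_aux[of X X k "card X" D] X assms by auto
  qed
  from iterated_extraction[of V k ?P, OF finite_V assms this]
  obtain T X Y s where T: "real T \<le> k * root k (card V)"
    "(\<Sum>i<T. real (card (X i))) \<le> root k (card V) * card V"
    "\<forall>i<T. X i \<subseteq> V \<and> ?P (X i) (Y i)"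
    "\<forall>u\<in>V. s u < T \<and> u \<in> Y (s u) \<and> (\<forall>i \<le> s u. u \<in> X i)"
    by blast
  from T(3) obtain xs where xs: "\<forall>i<T. distinct (xs i) \<and> set (xs i) = X i \<and>
      ramsey_order (16 * real k) (xs i) (Y i)" by metis
  then have "(\<Sum>i<T. real (length (xs i))) = (\<Sum>i<T. real (card (X i)))"
    by (intro sum.cong refl) (metis distinct_card lessThan_iff)
  moreover have "u \<in> set (xs i)" if "u \<in> V" "i \<le> s u" for u i
  proof -
    have "u \<in> X i" "i < T" using T(4) that by (auto dest: le_less_trans)
    then show ?thesis using xs by auto
  qed
  moreover have "\<exists>U. u \<in> U \<and> ramsey_order (16 * real k) (xs (s u)) U" if "u \<in> V" for u
    using T(4) xs that by blast
  ultimately show ?thesis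
    using T xs by (intro exI[of _ T] exI[of _ xs] exI[of _ s]) simp
qed

end

section \<open>The query program\<close>

text \<open>
  Registers 2 and 3 hold the constants 0 and 1. Lines 5 to 28 take the smaller of the two addresses
  of vertex blocks, look up the positions \<open>p\<close> and \<open>q\<close> in that block, the leading bit \<open>j\<close> of
  \<open>p xor q\<close>, and the entry for \<open>p\<close> and \<open>j\<close>. If cell 0 is 0, this entry is the middle vertex.
  Otherwise it is the index of a scale: lines 31 to 42 compute the initial interval of the binary
  search from both entries and the width in cell 5, lines 43 to 61 are the search, with the bounds
  \<open>hi\<close> and \<open>lo\<close> in registers 6 and 7, and lines 62 to 67 load the middle vertex. Lines 68 to 77 print
  the path, without the middle vertex if it is an endpoint.
\<close>

definition query_program :: program where
  "query_program =
    [Const 3 1, JumpLess 0 1 5, JumpLess 1 0 5, Output 0, Halt,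
     Const 4 6, Op Add 5 4 0, Load 5 5, Op Add 6 4 1, Load 6 6,
     JumpLess 5 6 12, Op Add 5 6 2,
     Op Add 6 5 0, Load 6 6, Op Add 7 5 1, Load 7 7,
     Op Xor 8 6 7, Const 9 3, Load 9 9, Op Add 8 8 9, Load 8 8,
     Load 9 3, Op Add 5 5 9, Op Add 5 5 8, Const 10 2, Load 10 10,
     Op Mul 6 6 10, Op Add 6 6 5, Load 6 6,
     Load 11 2, JumpLess 11 3 68,
     Op Mul 7 7 10, Op Add 7 7 5, Load 7 7, JumpLess 7 6 36, Op Add 6 7 2,
     Const 10 5, Load 10 10, Const 7 0, JumpLess 6 10 41, Op Sub 7 6 10,
     Const 10 4, Load 10 10,
     Op Sub 8 6 7, JumpLess 3 8 46, JumpLess 2 3 62,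
     Op Add 8 6 7, Op Shr 8 8 3,
     Op Mul 11 8 9, Op Add 11 11 10, Op Add 11 11 0, Load 11 11,
     Op Add 12 11 0, Load 12 12, Op Add 11 11 1, Load 11 11,
     JumpLess 11 12 60, JumpLess 12 11 60,
     Op Add 6 8 2, JumpLess 2 3 43,
     Op Add 7 8 2, JumpLess 2 3 43,
     Op Mul 11 6 9, Op Add 11 11 10, Op Add 11 11 0, Load 11 11, Op Add 11 11 0, Load 6 11,
     Output 0, JumpLess 6 0 72, JumpLess 0 6 72, JumpLess 2 3 76,
     JumpLess 6 1 75, JumpLess 1 6 75, JumpLess 2 3 76, Output 6, Output 1, Halt]"

section \<open>Symbolic execution of the query program\<close>

abbreviation run :: "nat \<Rightarrow> nat \<Rightarrow> ram_state \<Rightarrow> ram_state" where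
  "run W t \<equiv> step W query_program ^^ t"

lemma run_add: "run W (a + b) s = run W b (run W a s)"
  by (simp add: funpow_add add.commute[of a])

lemma run_0: "run W 0 s = s"
  by simp

lemma run_Suc: "run W (Suc t) s = run W t (step W query_program s)"
  by (simp only: funpow_Suc_right comp_apply)

lemma run_numeral: "run W (numeral t) s = run W (pred_numeral t) (step W query_program s)"
  by (simp only: numeral_eq_Suc run_Suc)

lemma length_query_program: "length query_program = 78"
  by (simp add: query_program_def)

lemma step_query:
  assumes "pc s < 78" "query_program ! pc s \<noteq> Halt"
  shows "step W query_program s = exec_instr W (query_program ! pc s) s"
  using assms by (simp add: step_def halted_def length_query_program)

text \<open>The program is unfolded only under an index, so that the simplifier executes one
  concrete instruction at a time on a symbolic state.\<close>

lemmas query_nth = arg_cong[OF query_program_def, where f = "\<lambda>xs. xs ! i" for i]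

lemmas exec_simps = run_numeral run_Suc run_0 step_query query_nth

text \<open>The machine branches only on strict comparison, so each test for inequality takes two
  jumps; hence the case distinctions and the varying number of steps.\<close>

lemma emit_path:
  assumes s: "pc s = 68" "regs s 0 = u" "regs s 1 = v" "regs s 2 = 0" "regs s 3 = 1"
    "regs s 6 = c" "outp s = []"
  shows "\<exists>t\<le>8. let s' = run W t s in pc s' = 77 \<and>
    outp s' = (if c = u \<or> c = v then [u, v] else [u, c, v])"
proof -
  consider "c < u" | "u < c" | "c = u" by linarith
  note cu = this
  consider "c < v" | "v < c" | "c = v" by linarith
  note cv = this
  from cu show ?thesis
  proof cases
    case 1
    from cv show ?thesis
    proof cases
      case 1
      then show ?thesis using s \<open>c < u\<close> by (intro exI[of _ 5]) (simp add: exec_simps)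
    next
      case 2
      then show ?thesis using s \<open>c < u\<close> by (intro exI[of _ 6]) (simp add: exec_simps)
    next
      case 3
      then show ?thesis using s \<open>c < u\<close> by (intro exI[of _ 6]) (simp add: exec_simps)
    qed
  next
    case 2
    from cv show ?thesis
    proof cases
      case 1
      then show ?thesis using s \<open>u < c\<close> by (intro exI[of _ 6]) (simp add: exec_simps)
    next
      case 2
      then show ?thesis using s \<open>u < c\<close> by (intro exI[of _ 7]) (simp add: exec_simps)
    next
      case 3
      then show ?thesis using s \<open>u < c\<close> by (intro exI[of _ 7]) (simp add: exec_simps)
    qed
  next
    case 3
    then show ?thesis using s by (intro exI[of _ 5]) (simp add: exec_simps)
  qed
qed

lemma answer_equal_vertices:
  assumes "query_prog D = query_program" "0 < word_size D"
  shows "answers_in D u u [u] 4"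
proof -
  have "Suc 0 < 2 ^ word_size D" using one_less_power[of "2::nat" "word_size D"] assms(2) by simp
  then show ?thesis
    by (simp add: answers_in_def assms(1) exec_simps oracle_init_def halted_def)
qed

lemma sub_mod_word: "b \<le> a \<Longrightarrow> a < 2 ^ W \<Longrightarrow> (a + (2 ^ W - b)) mod 2 ^ W = a - (b::nat)"
  by (simp add: mod_if)

lemma binary_search_exit_run:
  assumes s: "pc s = 43" "regs s 0 = u" "regs s 1 = v" "regs s 2 = 0" "regs s 3 = 1"
    "regs s 6 = hi" "regs s 7 = lo" "regs s 9 = n" "regs s 10 = b" "mem s = m" "outp s = []"
    and hi: "hi = Suc lo" "hi < 2 ^ W"
    and W: "hi * n + b + u < 2 ^ W" "m (hi * n + b + u) + u < 2 ^ W"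
  shows "\<exists>s'. run W 9 s = s' \<and> pc s' = 68 \<and> regs s' 0 = u \<and> regs s' 1 = v \<and>
    regs s' 2 = 0 \<and> regs s' 3 = 1 \<and> regs s' 6 = m (m (hi * n + b + u) + u) \<and> outp s' = []"
proof -
  have sub: "(hi + (2 ^ W - lo)) mod 2 ^ W = Suc 0"
    using sub_mod_word[of lo hi W] hi by simp
  have lt: "hi * n < 2 ^ W" "hi * n + b < 2 ^ W" using W by auto
  show ?thesis using s W lt sub by (simp add: exec_simps)
qed

text \<open>Equality of labels is again tested by two jumps, which makes the run one step shorter if
  the first jump is taken. The bounds on \<open>W\<close> exclude wrap-around.\<close>

lemma binary_search_step_run:
  assumes s: "pc s = 43" "regs s 0 = u" "regs s 1 = v" "regs s 2 = 0" "regs s 3 = 1"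
    "regs s 6 = hi" "regs s 7 = lo" "regs s 9 = n" "regs s 10 = b" "mem s = m" "outp s = []"
    and hi: "Suc lo < hi" "hi + lo < 2 ^ W" and mid: "mid = (hi + lo) div 2"
    and W: "mid * n + b + u < 2 ^ W" "m (mid * n + b + u) + u < 2 ^ W"
      "m (mid * n + b + u) + v < 2 ^ W"
  shows "\<exists>t\<le>16. \<exists>s'. run W t s = s' \<and> pc s' = 43 \<and> regs s' 0 = u \<and> regs s' 1 = v \<and>
    regs s' 2 = 0 \<and> regs s' 3 = 1 \<and> regs s' 9 = n \<and> regs s' 10 = b \<and> mem s' = m \<and> outp s' = [] \<and>
    (if m (m (mid * n + b + u) + u) = m (m (mid * n + b + u) + v)
     then regs s' 6 = mid \<and> regs s' 7 = lo else regs s' 6 = hi \<and> regs s' 7 = mid)"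
proof -
  have sub: "(hi + (2 ^ W - lo)) mod 2 ^ W = hi - lo"
    using sub_mod_word[of lo hi W] hi by simp
  have gap: "Suc 0 < hi - lo" using hi by simp
  have lt: "mid * n < 2 ^ W" "mid * n + b < 2 ^ W" "mid < 2 ^ W" using W mid hi by auto
  let ?x = "m (m (mid * n + b + u) + u)" and ?y = "m (m (mid * n + b + u) + v)"
  consider "?y < ?x" | "?x < ?y" | "?x = ?y" by linarith
  then show ?thesis
  proof cases
    case 1
    then show ?thesis using s W lt sub gap hi(2) by (intro exI[of _ 15]) (simp add: exec_simps mid[symmetric])
  next
    case 2
    then show ?thesis using s W lt sub gap hi(2) by (intro exI[of _ 16]) (simp add: exec_simps mid[symmetric])
  next
    case 3
    then show ?thesis using s W lt sub gap hi(2) by (intro exI[of _ 16]) (simp add: exec_simps mid[symmetric])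
  qed
qed

text \<open>
  Here \<open>m (m (i * n + b + u) + x)\<close> is the label of \<open>x\<close> in the home row of \<open>u\<close> at scale \<open>i\<close>.
\<close>

lemma binary_search_run:
  assumes s: "pc s = 43" "regs s 0 = u" "regs s 1 = v" "regs s 2 = 0" "regs s 3 = 1"
    "regs s 6 = hi" "regs s 7 = lo" "regs s 9 = n" "regs s 10 = b" "mem s = m" "outp s = []"
    and lohi: "lo < hi" "hi - lo \<le> 2 ^ a" "hi \<le> S"
    and hi: "m (m (hi * n + b + u) + u) = m (m (hi * n + b + u) + v)"
    and W: "2 * S < 2 ^ W" "\<And>i. i \<le> S \<Longrightarrow> i * n + b + u < 2 ^ W"
    "\<And>i. i \<le> S \<Longrightarrow> m (i * n + b + u) + u < 2 ^ W"
    "\<And>i. i \<le> S \<Longrightarrow> m (i * n + b + u) + v < 2 ^ W"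
  shows "\<exists>t \<le> 16 * a + 9. \<exists>h s'. run W t s = s' \<and> pc s' = 68 \<and> regs s' 0 = u \<and> regs s' 1 = v \<and>
    regs s' 2 = 0 \<and> regs s' 3 = 1 \<and> regs s' 6 = m (m (h * n + b + u) + u) \<and> outp s' = [] \<and>
    lo < h \<and> h \<le> hi \<and> m (m (h * n + b + u) + u) = m (m (h * n + b + u) + v) \<and>
    (h = Suc lo \<or> m (m ((h - 1) * n + b + u) + u) \<noteq> m (m ((h - 1) * n + b + u) + v))"
  using s lohi hi
\<comment> \<open>The invariant is success of the test at \<open>hi\<close>. The test need not be
  monotone in the scale, and nothing is assumed at \<open>lo\<close>; therefore the conclusion
  allows either the initial lower bound or a failure just below \<open>h\<close>.\<close>
proof (induction a arbitrary: s lo hi)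
  case 0
  then have "hi = Suc lo" "hi < 2 ^ W" using W(1) by auto
  from binary_search_exit_run[OF 0(1-11) this W(2,3)] 0 this(1)
  show ?case by (intro exI[of _ 9] conjI exI[of _ hi] exI[of _ "run W 9 s"]) simp_all
next
  case (Suc a)
  show ?case
  proof (cases "hi = Suc lo")
    case True
    then have "hi < 2 ^ W" using W(1) Suc.prems by auto
    from binary_search_exit_run[OF Suc.prems(1-11) True this W(2,3)] Suc.prems True
    show ?thesis by (intro exI[of _ 9] conjI exI[of _ hi] exI[of _ "run W 9 s"]) simp_all
  next
    case False
    define mid where "mid = (hi + lo) div 2"
    have mid: "lo < mid" "mid < hi" "hi - mid \<le> 2 ^ a" "mid - lo \<le> 2 ^ a"
      using False Suc.prems(12,13) by (auto simp: mid_def)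
    have "Suc lo < hi" "hi + lo < 2 ^ W" using False Suc.prems W(1) by auto
    have S: "mid \<le> S" using mid(2) Suc.prems(14) by linarith
    from binary_search_step_run[OF Suc.prems(1-11) \<open>Suc lo < hi\<close> \<open>hi + lo < 2 ^ W\<close>
        mid_def W(2)[OF S] W(3)[OF S] W(4)[OF S]]
    obtain t s' where t: "t \<le> 16" "run W t s = s'" "pc s' = 43" "regs s' 0 = u" "regs s' 1 = v"
      "regs s' 2 = 0" "regs s' 3 = 1" "regs s' 9 = n" "regs s' 10 = b" "mem s' = m" "outp s' = []"
      and t': "if m (m (mid * n + b + u) + u) = m (m (mid * n + b + u) + v)
        then regs s' 6 = mid \<and> regs s' 7 = lo else regs s' 6 = hi \<and> regs s' 7 = mid"
      by blast
    show ?thesis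
    proof (cases "m (m (mid * n + b + u) + u) = m (m (mid * n + b + u) + v)")
      case True
      have "regs s' 6 = mid" "regs s' 7 = lo" "mid \<le> S" using t' True mid Suc.prems by auto
      from Suc.IH[OF t(3-7) this(1,2) t(8-11) mid(1,4) this(3) True]
      obtain t2 h s2 where *: "t2 \<le> 16 * a + 9" "run W t2 s' = s2" "pc s2 = 68"
        "regs s2 0 = u" "regs s2 1 = v" "regs s2 2 = 0" "regs s2 3 = 1"
        "regs s2 6 = m (m (h * n + b + u) + u)" "outp s2 = []" "lo < h" "h \<le> mid"
        "m (m (h * n + b + u) + u) = m (m (h * n + b + u) + v)"
        "h = Suc lo \<or> m (m ((h - 1) * n + b + u) + u) \<noteq> m (m ((h - 1) * n + b + u) + v)"
        by blast
      show ?thesis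
        using * t(1,2) mid by (intro exI[of _ "t + t2"] conjI exI[of _ h] exI[of _ s2]) (auto simp: run_add)
    next
      case False
      have "regs s' 6 = hi" "regs s' 7 = mid" using t' False by auto
      from Suc.IH[OF t(3-7) this(1,2) t(8-11) mid(2,3) Suc.prems(14,15)]
      obtain t2 h s2 where *: "t2 \<le> 16 * a + 9" "run W t2 s' = s2" "pc s2 = 68"
        "regs s2 0 = u" "regs s2 1 = v" "regs s2 2 = 0" "regs s2 3 = 1"
        "regs s2 6 = m (m (h * n + b + u) + u)" "outp s2 = []" "mid < h" "h \<le> hi"
        "m (m (h * n + b + u) + u) = m (m (h * n + b + u) + v)"
        "h = Suc mid \<or> m (m ((h - 1) * n + b + u) + u) \<noteq> m (m ((h - 1) * n + b + u) + v)"
        by blast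
      \<comment> \<open>Even if the search ends at \<open>Suc mid\<close>, the scale below is
        \<open>mid\<close>, where the test has failed.\<close>
      moreover have "m (m ((h - 1) * n + b + u) + u) \<noteq> m (m ((h - 1) * n + b + u) + v)"
        using *(13) False by auto
      ultimately show ?thesis
        using t(1,2) mid by (intro exI[of _ "t + t2"] conjI exI[of _ h] exI[of _ s2]) (auto simp: run_add)
    qed
  qed
qed

lemma distinct_vertices_run:
  assumes "pc s = 0" "regs s 0 = u" "regs s 1 = v" "regs s 2 = 0" "mem s = m" "outp s = []"
    and "u \<noteq> v" "0 < W"
  shows "\<exists>t\<le>3. \<exists>s'. run W t s = s' \<and> pc s' = 5 \<and> regs s' 0 = u \<and> regs s' 1 = v \<and> regs s' 2 = 0 \<and>
    regs s' 3 = 1 \<and> mem s' = m \<and> outp s' = []"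
proof -
  have one: "Suc 0 < 2 ^ W" using one_less_power[of "2::nat" W] assms(8) by simp
  consider "u < v" | "v < u" using assms(7) by linarith
  then show ?thesis
  proof cases
    case 1
    then show ?thesis using assms(1-6,8) one
      by (intro exI[of _ 2]) (simp add: exec_simps)
  next
    case 2
    then show ?thesis using assms(1-6,8) one
      by (intro exI[of _ 3]) (simp add: exec_simps)
  qed
qed

lemma tree_lookup_run:
  assumes s: "pc s = 5" "regs s 0 = u" "regs s 1 = v" "regs s 2 = 0" "regs s 3 = 1"
    "mem s = m" "outp s = []"
    and W: "(6::nat) < 2 ^ W" "6 + u < 2 ^ W" "6 + v < 2 ^ W"
    and b: "min (m (6 + u)) (m (6 + v)) = b" "b + u < 2 ^ W" "b + v < 2 ^ W"
  shows "\<exists>t\<le>7. \<exists>s'. run W t s = s' \<and> pc s' = 12 \<and> regs s' 0 = u \<and> regs s' 1 = v \<and>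
    regs s' 2 = 0 \<and> regs s' 3 = 1 \<and> regs s' 5 = b \<and> mem s' = m \<and> outp s' = []"
proof (cases "m (6 + u) < m (6 + v)")
  case True
  then show ?thesis using s W b by (intro exI[of _ 6]) (simp add: exec_simps)
next
  case False
  then have "b = m (6 + v)" using b by simp
  with False show ?thesis using s W b by (intro exI[of _ 7]) (simp add: exec_simps)
qed

lemma entry_lookup_run:
  assumes s: "pc s = 12" "regs s 0 = u" "regs s 1 = v" "regs s 2 = 0" "regs s 3 = 1" "regs s 5 = b"
    "mem s = m" "outp s = []"
    and h: "m 1 = n" "m 2 = g" "m 3 = lb" "b + u < 2 ^ W" "b + v < 2 ^ W" "(6::nat) < 2 ^ W"
    and pq: "m (b + u) = p" "m (b + v) = q" "Bit_Operations.xor p q = x" "m (x + lb) = j" "x + lb < 2 ^ W"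
    and e: "p * g + (b + n + j) < 2 ^ W"
  shows "\<exists>s'. run W 18 s = s' \<and> pc s' = 30 \<and> regs s' 0 = u \<and> regs s' 1 = v \<and>
    regs s' 2 = 0 \<and> regs s' 3 = 1 \<and> regs s' 5 = b + n + j \<and> regs s' 6 = m (p * g + (b + n + j)) \<and>
    regs s' 7 = q \<and> regs s' 9 = n \<and> regs s' 10 = g \<and> regs s' 11 = m 0 \<and> mem s' = m \<and> outp s' = []"
proof -
  have lt: "(3::nat) < 2 ^ W" "(2::nat) < 2 ^ W" "b + n < 2 ^ W" "b + n + j < 2 ^ W" "p * g < 2 ^ W"
    using h(6) e by auto
  show ?thesis using s h pq e lt by (simp add: exec_simps)
qed

text \<open>Machine subtraction wraps around, so the program branches on \<open>hi < R\<close> to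
  obtain the truncated difference \<open>hi - R\<close>.\<close>

lemma search_start_run:
  assumes s: "pc s = 30" "regs s 0 = u" "regs s 1 = v" "regs s 2 = 0" "regs s 3 = 1"
    "regs s 5 = y" "regs s 6 = e1" "regs s 7 = q" "regs s 9 = n" "regs s 10 = g" "regs s 11 = 1"
    "mem s = m" "outp s = []"
    and W: "(6::nat) < 2 ^ W" "q * g + y < 2 ^ W"
    and e2: "m (q * g + y) = e2" "max e1 e2 < 2 ^ W" "max e1 e2 = hi"
    and R: "m 4 = hb" "m 5 = R"
  shows "\<exists>t\<le>13. \<exists>s'. run W t s = s' \<and> pc s' = 43 \<and> regs s' 0 = u \<and> regs s' 1 = v \<and>
    regs s' 2 = 0 \<and> regs s' 3 = 1 \<and> regs s' 6 = hi \<and> regs s' 7 = hi - R \<and>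
    regs s' 9 = n \<and> regs s' 10 = hb \<and> mem s' = m \<and> outp s' = []"
proof -
  have lt: "(5::nat) < 2 ^ W" "(4::nat) < 2 ^ W" "q * g < 2 ^ W" using W by auto
  have e2lt: "e2 < 2 ^ W" "hi < 2 ^ W" using e2 by auto
  have sub: "R \<le> hi \<Longrightarrow> (hi + (2 ^ W - R)) mod 2 ^ W = hi - R"
    using sub_mod_word[of R hi W] e2lt by simp
  show ?thesis
  proof (cases "e2 < e1")
    case True
    then have e1: "e1 = hi" using e2 by simp
    show ?thesis
    proof (cases "hi < R")
      case True
      then show ?thesis using s W lt e1 R e2(1) \<open>e2 < e1\<close>
        by (intro exI[of _ 11]) (simp add: exec_simps)
    next
      case False
      then show ?thesis using s W lt e1 R e2(1) \<open>e2 < e1\<close> sub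
        by (intro exI[of _ 12]) (simp add: exec_simps)
    qed
  next
    case False
    then have "e2 = hi" using e2 by simp
    show ?thesis
    proof (cases "hi < R")
      case True
      then show ?thesis using s W lt \<open>e2 = hi\<close> R e2(1) \<open>\<not> e2 < e1\<close> e2lt
        by (intro exI[of _ 12]) (simp add: exec_simps)
    next
      case False
      then show ?thesis using s W lt \<open>e2 = hi\<close> R e2(1) \<open>\<not> e2 < e1\<close> sub e2lt
        by (intro exI[of _ 13]) (simp add: exec_simps)
    qed
  qed
qed

section \<open>Complete queries\<close>

definition stored_mem :: "ram_oracle \<Rightarrow> nat \<Rightarrow> nat" where
  "stored_mem D a = (if a < length (stored D) then stored D ! a else 0)"

text \<open>An answer has to be a simple path, so a middle vertex that equals an endpoint is
  dropped.\<close>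

definition via :: "nat \<Rightarrow> nat \<Rightarrow> nat \<Rightarrow> nat list" where
  "via u c v = (if c = u \<or> c = v then [u, v] else [u, c, v])"

lemma answers_inI:
  assumes "query_prog D = query_program" "run (word_size D) t (oracle_init D u v) = s"
    "pc s = 77" "outp s = xs"
  shows "answers_in D u v xs t"
  using assms by (simp add: answers_in_def halted_def query_nth)

text \<open>These are the facts about memory on which the lookup phase depends; the run is thus
  verified independently of the layout of the data.\<close>

locale entry_lookup =
  fixes D :: ram_oracle and m :: "nat \<Rightarrow> nat" and u v W b n g lb p q j y :: nat
  assumes prog: "query_prog D = query_program"
    and m_def: "m = stored_mem D" and W_def: "W = word_size D"
    and uv: "u \<noteq> v" and W6: "(6::nat) < 2 ^ W" "6 + u < 2 ^ W" "6 + v < 2 ^ W"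
    and b: "min (m (6 + u)) (m (6 + v)) = b" "b + u < 2 ^ W" "b + v < 2 ^ W"
    and h: "m 1 = n" "m 2 = g" "m 3 = lb"
    and pq: "m (b + u) = p" "m (b + v) = q" "m (Bit_Operations.xor p q + lb) = j"
      "Bit_Operations.xor p q + lb < 2 ^ W"
    and y: "y = b + n + j" "p * g + y < 2 ^ W"
begin

lemma lookup:
  "\<exists>t\<le>28. \<exists>s'. run W t (oracle_init D u v) = s' \<and> pc s' = 30 \<and> regs s' 0 = u \<and> regs s' 1 = v \<and>
    regs s' 2 = 0 \<and> regs s' 3 = 1 \<and> regs s' 5 = y \<and> regs s' 6 = m (p * g + y) \<and>
    regs s' 7 = q \<and> regs s' 9 = n \<and> regs s' 10 = g \<and> regs s' 11 = m 0 \<and> mem s' = m \<and> outp s' = []"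
proof -
  let ?s = "oracle_init D u v"
  have s: "pc ?s = 0" "regs ?s 0 = u" "regs ?s 1 = v" "regs ?s 2 = 0" "mem ?s = m" "outp ?s = []"
    by (simp_all add: oracle_init_def m_def stored_mem_def fun_eq_iff)
  have "0 < W" using W6(1) by (cases W) auto
  from distinct_vertices_run[OF s uv this] obtain t1 s1
    where t1: "t1 \<le> 3" "run W t1 ?s = s1" "pc s1 = 5" "regs s1 0 = u" "regs s1 1 = v" "regs s1 2 = 0"
      "regs s1 3 = 1" "mem s1 = m" "outp s1 = []" by blast
  from tree_lookup_run[OF t1(3-9) W6 b] obtain t2 s2
    where t2: "t2 \<le> 7" "run W t2 s1 = s2" "pc s2 = 12" "regs s2 0 = u" "regs s2 1 = v"
      "regs s2 2 = 0" "regs s2 3 = 1" "regs s2 5 = b" "mem s2 = m" "outp s2 = []" by blast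
  have "run W (t1 + t2 + 18) ?s = run W 18 s2" using t1 t2 by (simp only: run_add)
  with entry_lookup_run[OF t2(3-10) h b(2,3) W6(1) pq(1,2) refl pq(3,4)] y t1(1) t2(1)
  show ?thesis by (intro exI[of _ "t1 + t2 + 18"]) simp
qed

lemma answer_direct:
  assumes "m 0 = 0"
  shows "\<exists>t\<le>40. answers_in D u v (via u (m (p * g + y)) v) t"
proof -
  let ?c = "m (p * g + y)"
  obtain t s where t: "t \<le> 28" "run W t (oracle_init D u v) = s" "pc s = 30" "regs s 0 = u" "regs s 1 = v"
    "regs s 2 = 0" "regs s 3 = 1" "regs s 6 = ?c" "regs s 11 = 0" "outp s = []"
    using lookup assms by auto
  have "pc (run W 1 s) = 68" "regs (run W 1 s) 0 = u" "regs (run W 1 s) 1 = v" "regs (run W 1 s) 2 = 0"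
    "regs (run W 1 s) 3 = 1" "regs (run W 1 s) 6 = ?c" "outp (run W 1 s) = []"
    using t by (simp_all add: exec_simps)
  from emit_path[OF this, of W] obtain t2 where "t2 \<le> 8" "pc (run W t2 (run W 1 s)) = 77"
    "outp (run W t2 (run W 1 s)) = via u ?c v" by (auto simp: via_def Let_def)
  moreover have "run W (t + 1 + t2) (oracle_init D u v) = run W t2 (run W 1 s)"
    using t(2) by (simp only: run_add)
  ultimately show ?thesis
    using t(1) answers_inI[OF prog] by (intro exI[of _ "t + 1 + t2"]) (auto simp: W_def)
qed

lemma answer_by_search:
  assumes "m 0 = 1" "m 4 = hb" "m 5 = R" "0 < R"
    and e: "q * g + y < 2 ^ W" "max (m (p * g + y)) (m (q * g + y)) = hi"
    and hi: "0 < hi" "hi \<le> S" "R \<le> 2 ^ a"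
    and test_hi: "m (m (hi * n + hb + u) + u) = m (m (hi * n + hb + u) + v)"
    and W: "2 * S < 2 ^ W" "\<And>i. i \<le> S \<Longrightarrow> i * n + hb + u < 2 ^ W"
    "\<And>i. i \<le> S \<Longrightarrow> m (i * n + hb + u) + u < 2 ^ W"
    "\<And>i. i \<le> S \<Longrightarrow> m (i * n + hb + u) + v < 2 ^ W"
  shows "\<exists>t \<le> 16 * a + 60. \<exists>h. hi - R < h \<and> h \<le> hi \<and>
    m (m (h * n + hb + u) + u) = m (m (h * n + hb + u) + v) \<and>
    (h = Suc (hi - R) \<or> m (m ((h - 1) * n + hb + u) + u) \<noteq> m (m ((h - 1) * n + hb + u) + v)) \<and>
    answers_in D u v (via u (m (m (h * n + hb + u) + u)) v) t"
proof -
  obtain t s where t: "t \<le> 28" "run W t (oracle_init D u v) = s" "pc s = 30" "regs s 0 = u" "regs s 1 = v"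
    "regs s 2 = 0" "regs s 3 = 1" "regs s 5 = y" "regs s 6 = m (p * g + y)"
    "regs s 7 = q" "regs s 9 = n" "regs s 10 = g" "regs s 11 = 1" "mem s = m" "outp s = []"
    using lookup assms(1) by auto
  have "max (m (p * g + y)) (m (q * g + y)) < 2 ^ W" using e(2) hi(2) W(1) by simp
  from search_start_run[OF t(3-15) W6(1) e(1) refl this e(2) assms(2,3)]
  obtain t1 s1 where t1: "t1 \<le> 13" "run W t1 s = s1" "pc s1 = 43" "regs s1 0 = u" "regs s1 1 = v"
    "regs s1 2 = 0" "regs s1 3 = 1" "regs s1 6 = hi" "regs s1 7 = hi - R"
    "regs s1 9 = n" "regs s1 10 = hb" "mem s1 = m" "outp s1 = []" by blast
  have "hi - R < hi" "hi - (hi - R) \<le> 2 ^ a" using hi assms(4) by auto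
  from binary_search_run[OF t1(3-13) this hi(2) test_hi W]
  obtain t2 h s2 where t2: "t2 \<le> 16 * a + 9" "run W t2 s1 = s2" "pc s2 = 68" "regs s2 0 = u"
    "regs s2 1 = v" "regs s2 2 = 0" "regs s2 3 = 1" "regs s2 6 = m (m (h * n + hb + u) + u)" "outp s2 = []"
    "hi - R < h" "h \<le> hi" "m (m (h * n + hb + u) + u) = m (m (h * n + hb + u) + v)"
    "h = Suc (hi - R) \<or> m (m ((h - 1) * n + hb + u) + u) \<noteq> m (m ((h - 1) * n + hb + u) + v)"
    by blast
  from emit_path[OF t2(3-9), of W] obtain t3 where t3: "t3 \<le> 8" "pc (run W t3 s2) = 77"
    "outp (run W t3 s2) = via u (m (m (h * n + hb + u) + u)) v" by (auto simp: via_def Let_def)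
  have "run W (t + t1 + t2 + t3) (oracle_init D u v) = run W t3 s2"
    using t(2) t1(2) t2(2) by (simp only: run_add)
  then have "answers_in D u v (via u (m (m (h * n + hb + u) + u)) v) (t + t1 + t2 + t3)"
    using answers_inI[OF prog] t3 by (auto simp: W_def)
  moreover have "t + t1 + t2 + t3 \<le> 16 * a + 60" using t(1) t1(1) t2(1) t3(1) by linarith
  ultimately show ?thesis using t2(10-13) by blast
qed

end

section \<open>Emulators with metric weights\<close>

abbreviation rdist :: "'a pair_pre_digraph \<Rightarrow> ('a \<times> 'a) weight_fun \<Rightarrow> 'a \<Rightarrow> 'a \<Rightarrow> real" where
  "rdist G w u v \<equiv> real_of_ereal (gdist G w u v)"

context
  fixes G :: "'a pair_pre_digraph" and w :: "('a \<times> 'a) weight_fun"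
  assumes G: "weighted_graph G w" and conn: "connected (with_proj G)"
begin

interpretation pair_graph G
  using G by (simp add: weighted_graph_def)

lemma arc_weight: "e \<in> parcs G \<Longrightarrow> 0 < w e \<and> w (prod.swap e) = w e"
  using G by (cases e) (auto simp: weighted_graph_def)

text \<open>Positive weights exclude negative cycles, so the infimum over walks is attained by a
  simple path; in particular distances are finite.\<close>

lemma shortest_apath:
  assumes "u \<in> pverts G" "v \<in> pverts G"
  obtains p where "apath u p v" "gdist G w u v = ereal (awalk_cost w p)"
proof -
  have "reachable (with_proj G) u v"
    using conn assms by (auto simp: connected_def strongly_connected_def reachable_mk_symmetric_eq[OF sym_arcs])
  from min_cost_awalk[OF this, of w] arc_weight that show ?thesis by force
qed

lemma gdist_eq_rdist:
  assumes "u \<in> pverts G" "v \<in> pverts G"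
  shows "gdist G w u v = ereal (rdist G w u v)"
  using shortest_apath[OF assms] by (metis real_of_ereal.simps(1))

lemma rdist_le_awalk_cost:
  assumes "awalk u p v"
  shows "rdist G w u v \<le> awalk_cost w p"
proof -
  have "u \<in> pverts G" "v \<in> pverts G" using assms by auto
  then have "ereal (rdist G w u v) \<le> ereal (awalk_cost w p)"
    using min_cost_le_walk_cost[OF assms, of w] gdist_eq_rdist by metis
  then show ?thesis by simp
qed

lemma shortest_awalk:
  assumes "u \<in> pverts G" "v \<in> pverts G"
  obtains p where "awalk u p v" "rdist G w u v = awalk_cost w p"
  using shortest_apath[OF assms] by (metis awalkI_apath real_of_ereal.simps(1))

lemma awalk_cost_rev_path: "set p \<subseteq> parcs G \<Longrightarrow> awalk_cost w (rev_path p) = awalk_cost w p"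
  using arc_weight by (induction p) (auto simp: prod.swap_def)

lemma awalk_cost_pos:
  assumes "set p \<subseteq> parcs G" "p \<noteq> []"
  shows "0 < awalk_cost w p"
  using assms
proof (induction p)
  case (Cons e p)
  then show ?case using arc_weight[of e] by (cases p) auto
qed simp

lemma rdist_sym_le:
  assumes "u \<in> pverts G" "v \<in> pverts G"
  shows "rdist G w v u \<le> rdist G w u v"
proof -
  obtain p where p: "awalk u p v" "rdist G w u v = awalk_cost w p" using shortest_awalk[OF assms] .
  then have "awalk v (rev_path p) u" by simp
  from rdist_le_awalk_cost[OF this] p show ?thesis by (simp add: awalk_cost_rev_path awalk_def)
qed

lemma finite_metric_rdist: "finite_metric (pverts G) (rdist G w)"
proof
  fix x y z assume x: "x \<in> pverts G"
  show "rdist G w x x = 0"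
  proof -
    have "rdist G w x x \<le> 0" using rdist_le_awalk_cost[of x "[]" x] x by (simp add: awalk_Nil_iff)
    moreover obtain p where "awalk x p x" "rdist G w x x = awalk_cost w p" using shortest_awalk[OF x x] .
    ultimately show ?thesis using awalk_cost_pos[of p] by (cases "p = []") (auto simp: awalk_def)
  qed
  assume y: "y \<in> pverts G"
  show "rdist G w x y = rdist G w y x" using rdist_sym_le x y by (meson order_antisym)
  obtain p where p: "awalk x p y" "rdist G w x y = awalk_cost w p" using shortest_awalk[OF x y] .
  show "0 < rdist G w x y" if "x \<noteq> y"
    using p that awalk_cost_pos[of p] by (cases "p = []") (auto simp: awalk_def)
  assume z: "z \<in> pverts G"
  obtain q where q: "awalk y q z" "rdist G w y z = awalk_cost w q" using shortest_awalk[OF y z] .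
  have "awalk x (p @ q) z" using p q by (simp add: awalk_appendI)
  from rdist_le_awalk_cost[OF this] p q
  show "rdist G w x z \<le> rdist G w x y + rdist G w y z" by simp
qed (rule pair_finite_verts)

end

section \<open>Graphs weighted by a metric\<close>

text \<open>Symmetrising and dropping loops here lets \<open>F\<close> be any set of ordered pairs,
  while its cardinality still bounds the number of edges.\<close>

definition metric_graph :: "'a set \<Rightarrow> ('a \<times> 'a) set \<Rightarrow> 'a pair_pre_digraph" where
  "metric_graph V F =
     \<lparr>pverts = V, parcs = {(x, y) \<in> V \<times> V. x \<noteq> y \<and> ((x, y) \<in> F \<or> (y, x) \<in> F)}\<rparr>"

lemma pverts_metric_graph [simp]: "pverts (metric_graph V F) = V"
  by (simp add: metric_graph_def)

lemma parcs_metric_graph: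
  "(x, y) \<in> parcs (metric_graph V F) \<longleftrightarrow> x \<in> V \<and> y \<in> V \<and> x \<noteq> y \<and> ((x, y) \<in> F \<or> (y, x) \<in> F)"
  by (auto simp: metric_graph_def)

lemma card_edge_set_metric_graph:
  assumes "finite F"
  shows "card (edge_set (metric_graph V F)) \<le> card F"
proof -
  have "edge_set (metric_graph V F) \<subseteq> (\<lambda>(x, y). {x, y}) ` F"
    by (force simp: edge_set_def metric_graph_def)
  then show ?thesis using assms by (meson card_image_le card_mono finite_imageI le_trans)
qed

context finite_metric
begin

lemma weighted_metric_graph: "weighted_graph (metric_graph V F) (\<lambda>(x, y). d x y)"
proof -
  let ?A = "parcs (metric_graph V F)"
  have "finite ?A" using finite_V by (auto simp: metric_graph_def intro: finite_subset[of _ "V \<times> V"])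
  moreover have "sym ?A" by (auto simp: metric_graph_def sym_def)
  ultimately have "pair_graph (metric_graph V F)"
    using finite_V by unfold_locales (auto simp: parcs_metric_graph symmetric_def)
  then show ?thesis using d_pos d_sym by (auto simp: weighted_graph_def parcs_metric_graph)
qed

end

text \<open>The triangle inequality along the walk; it shows that metric weights never shorten a
  distance.\<close>

lemma rdist_le_metric_awalk_cost:
  assumes "finite_metric V d"
    and "pre_digraph.awalk (with_proj (metric_graph V F)) u p v"
  shows "d u v \<le> wf_digraph.awalk_cost (\<lambda>(x, y). d x y) p"
proof -
  interpret finite_metric V d by fact
  interpret H: pair_graph "metric_graph V F"
    using weighted_metric_graph by (simp add: weighted_graph_def)
  show ?thesis using assms(2)
  proof (induction p arbitrary: u)
    case Nil
    then show ?case using d_self by (auto simp: H.awalk_Nil_iff)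
  next
    case (Cons e p)
    obtain y where e: "e = (u, y)" "(u, y) \<in> parcs (metric_graph V F)" "H.awalk y p v"
      using Cons.prems by (cases e) (auto simp: H.awalk_Cons_iff)
    have "v \<in> V" using e(3) by (auto dest: H.awalk_last_in_verts)
    then have "d u v \<le> d u y + d y v" using e by (intro d_triangle) (auto simp: parcs_metric_graph)
    also have "\<dots> \<le> H.awalk_cost (\<lambda>(x, y). d x y) (e # p)" using Cons.IH[OF e(3)] e(1) by simp
    finally show ?case .
  qed
qed

text \<open>The two-hop paths that answer the queries also witness the upper bound on distances in
  the emulator, so one condition on \<open>c\<close> yields both.\<close>

lemma interactive_emulatorI:
  fixes G :: "nat pair_pre_digraph" and w :: "(nat \<times> nat) weight_fun"
  defines "d \<equiv> rdist G w"
  assumes G: "weighted_graph G w" "connected (with_proj G)"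
    and T: "\<And>l. b \<le> T l"
    and self: "\<And>u. u \<in> pverts G \<Longrightarrow> \<exists>t. answers_in D u u [u] t \<and> real t \<le> b"
    and hop: "\<And>u v. u \<in> pverts G \<Longrightarrow> v \<in> pverts G \<Longrightarrow> u \<noteq> v \<Longrightarrow>
      \<exists>c\<in>pverts G. (c = u \<or> (u, c) \<in> F \<or> (c, u) \<in> F) \<and> (c = v \<or> (v, c) \<in> F \<or> (c, v) \<in> F) \<and>
        d u c + d c v \<le> \<alpha> * d u v \<and> (\<exists>t. answers_in D u v (via u c v) t \<and> real t \<le> b)"
  shows "interactive_emulator \<alpha> G w (metric_graph (pverts G) F) (\<lambda>(x, y). d x y) D T"
proof -
  interpret finite_metric "pverts G" d unfolding d_def by (rule finite_metric_rdist[OF G])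
  let ?H = "metric_graph (pverts G) F" and ?w = "\<lambda>(x, y). d x y"
  interpret H: pair_graph ?H
    using weighted_metric_graph by (simp add: weighted_graph_def)
  have gd: "gdist G w u v = ereal (d u v)" if "u \<in> pverts G" "v \<in> pverts G" for u v
    unfolding d_def by (rule gdist_eq_rdist[OF G that])
  have path: "\<exists>p t. H.apath u p v \<and> d u v \<le> H.awalk_cost ?w p \<and> H.awalk_cost ?w p \<le> \<alpha> * d u v \<and>
      answers_in D u v (pawalk_verts u p) t \<and> real t \<le> b"
    if uv: "u \<in> pverts G" "v \<in> pverts G" for u v
  proof (cases "u = v")
    case True
    then show ?thesis using self[OF uv(1)] uv
      by (intro exI[of _ "[]"]) (auto simp: d_self H.apath_Nil_iff)
  next
    case False
    from hop[OF uv this] obtain c t where c: "c \<in> pverts G" "c = u \<or> (u, c) \<in> F \<or> (c, u) \<in> F"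
      "c = v \<or> (v, c) \<in> F \<or> (c, v) \<in> F" "d u c + d c v \<le> \<alpha> * d u v"
      "answers_in D u v (via u c v) t" "real t \<le> b" by blast
    \<comment> \<open>If \<open>c\<close> is one endpoint, the condition for the other endpoint says
      that the pair \<open>u\<close>, \<open>v\<close> itself is in \<open>F\<close>.\<close>
    define p where "p = (if c = u \<or> c = v then [(u, v)] else [(u, c), (c, v)])"
    have "H.apath u p v"
      using c uv False by (auto simp: p_def H.apath_Cons_iff H.apath_Nil_iff parcs_metric_graph)
    moreover have "H.awalk_cost ?w p \<le> d u c + d c v"
      using c(1) uv by (auto simp: p_def d_self)
    moreover have "pawalk_verts u p = via u c v" by (auto simp: p_def via_def)
    moreover have "d u v \<le> H.awalk_cost ?w p"
      using rdist_le_metric_awalk_cost[OF finite_metric_axioms] \<open>H.apath u p v\<close> H.awalkI_apath by blast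
    ultimately show ?thesis using c by (intro exI[of _ p] exI[of _ t]) auto
  qed
  have "emulator \<alpha> G w ?H ?w"
    unfolding emulator_def
  proof (intro conjI ballI)
    fix u v assume uv: "u \<in> pverts G" "v \<in> pverts G"
    show "gdist G w u v \<le> gdist ?H ?w u v"
      unfolding gd[OF uv] H.\<mu>_def
      using rdist_le_metric_awalk_cost[OF finite_metric_axioms] by (auto intro!: INF_greatest)
    obtain p where p: "H.apath u p v" "H.awalk_cost ?w p \<le> \<alpha> * d u v" using path[OF uv] by blast
    then have "gdist ?H ?w u v \<le> ereal (H.awalk_cost ?w p)"
      by (intro H.min_cost_le_walk_cost H.awalkI_apath)
    also have "\<dots> \<le> ereal \<alpha> * gdist G w u v" using p(2) gd[OF uv] by simp
    finally show "gdist ?H ?w u v \<le> ereal \<alpha> * gdist G w u v" .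
  qed (use weighted_metric_graph in auto)
  moreover have "\<exists>p t. H.apath u p v \<and> gdist G w u v \<le> ereal (H.awalk_cost ?w p) \<and>
      ereal (H.awalk_cost ?w p) \<le> ereal \<alpha> * gdist G w u v \<and>
      answers_in D u v (pawalk_verts u p) t \<and> real t \<le> T (length p)"
    if uv: "u \<in> pverts G" "v \<in> pverts G" for u v
  proof -
    obtain p t where "H.apath u p v" "d u v \<le> H.awalk_cost ?w p" "H.awalk_cost ?w p \<le> \<alpha> * d u v"
      "answers_in D u v (pawalk_verts u p) t" "real t \<le> b"
      using path[OF uv] by blast
    then show ?thesis
      using gd[OF uv] T[of "length p"] by (intro exI[of _ p] exI[of _ t]) auto
  qed
  ultimately show ?thesis unfolding interactive_emulator_def by blast
qed

section \<open>The data structure\<close>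

lemma sum_lessThan_add: "(\<Sum>j<a + b. f j) = (\<Sum>j<a. f j) + (\<Sum>j<b. (f (a + j) :: nat))" for a b :: nat
  by (induction b) auto

definition segment_start :: "(nat \<Rightarrow> nat) \<Rightarrow> nat \<Rightarrow> nat" where
  "segment_start len i = (\<Sum>j<i. len j)"

definition segments :: "nat \<Rightarrow> (nat \<Rightarrow> nat) \<Rightarrow> (nat \<Rightarrow> nat \<Rightarrow> nat) \<Rightarrow> nat list" where
  "segments N len cell = concat (map (\<lambda>i. map (cell i) [0..<len i]) [0..<N])"

lemma segments_Suc: "segments (Suc N) len cell = segments N len cell @ map (cell N) [0..<len N]"
  by (simp add: segments_def)

lemma length_segments: "length (segments N len cell) = segment_start len N"
proof (induction N)
  case (Suc N)
  then show ?case by (simp add: segments_Suc segment_start_def)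
qed (simp add: segments_def segment_start_def)

lemma segment_start_mono: "i \<le> j \<Longrightarrow> segment_start len i \<le> segment_start len j"
  unfolding segment_start_def by (intro sum_mono2) auto

lemma segment_address_less:
  assumes "i < N" "a < len i"
  shows "segment_start len i + a < segment_start len N"
proof -
  have "segment_start len i + a < segment_start len (Suc i)"
    using assms(2) by (simp add: segment_start_def)
  also have "\<dots> \<le> segment_start len N" using assms(1) by (intro segment_start_mono) simp
  finally show ?thesis .
qed

lemma nth_segments:
  "i < N \<Longrightarrow> a < len i \<Longrightarrow> segments N len cell ! (segment_start len i + a) = cell i a"
proof (induction N)
  case (Suc N)
  show ?case
  proof (cases "i < N")
    case True
    then show ?thesis using Suc segment_address_less[of i N a len]
      by (simp add: segments_Suc nth_append length_segments)
  next
    case False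
    then have "i = N" using Suc.prems by simp
    then show ?thesis using Suc.prems by (simp add: segments_Suc nth_append length_segments)
  qed
qed simp

lemma set_segments: "set (segments N len cell) = {cell i a | i a. i < N \<and> a < len i}"
  unfolding segments_def by fastforce

lemma row_index_less:
  fixes a b c n :: nat
  assumes "a < b" "c < n"
  shows "a * n + c < b * n"
proof -
  have "a * n + c < Suc a * n" using assms(2) by simp
  also have "\<dots> \<le> b * n" using assms(1) by (intro mult_le_mono1) simp
  finally show ?thesis .
qed

lemma xor_eq_zero_nat: "Bit_Operations.xor p q = 0 \<Longrightarrow> p = (q::nat)"
  by (metis xor.assoc xor.left_neutral xor.right_neutral xor_self_eq)

text \<open>
  The number \<open>p\<close> with its \<open>j\<close> lowest bits cleared and bit \<open>j\<close> set. If \<open>j\<close> is the highest bit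
  in which \<open>p\<close> and \<open>q\<close> differ, this depends only on the bits that they share.
\<close>

definition midpoint :: "nat \<Rightarrow> nat \<Rightarrow> nat" where
  "midpoint j p = (2 * (p div 2 ^ Suc j) + 1) * 2 ^ j"

text \<open>Above bit \<open>j\<close> the numbers agree, and at bit \<open>j\<close> the larger has
  1 and the smaller 0. Clearing the lower bits of \<open>q\<close> hence gives a number above
  \<open>p\<close>.\<close>

lemma midpoint_between:
  assumes "p < q" and j: "j = floor_log (Bit_Operations.xor p q)"
  shows "midpoint j p = midpoint j q" "p < midpoint j q" "midpoint j q \<le> q"
proof -
  let ?x = "Bit_Operations.xor p q"
  have "0 < ?x" using assms(1) xor_eq_zero_nat[of p q] by auto
  then have x: "2 ^ j \<le> ?x" "?x < 2 ^ Suc j"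
    using floor_log_exp2_le[of ?x] floor_log_exp2_gt[of ?x] j by auto
  have "Bit_Operations.xor (p div 2 ^ Suc j) (q div 2 ^ Suc j) = ?x div 2 ^ Suc j"
    unfolding drop_bit_eq_div[symmetric] by simp
  also have "\<dots> = 0" using x(2) by simp
  finally have a: "p div 2 ^ Suc j = q div 2 ^ Suc j"
    by (rule xor_eq_zero_nat)
  then show "midpoint j p = midpoint j q" by (simp add: midpoint_def)
  have "Bit_Operations.xor (p div 2 ^ j) (q div 2 ^ j) = ?x div 2 ^ j"
    unfolding drop_bit_eq_div[symmetric] by simp
  moreover have "0 < ?x div 2 ^ j" using x(1) by (simp add: div_greater_zero_iff)
  ultimately have "p div 2 ^ j \<noteq> q div 2 ^ j" by (metis less_irrefl xor_self_eq)
  moreover have "p div 2 ^ j \<le> q div 2 ^ j" using assms(1) by (intro div_le_mono) simp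
  ultimately have less: "p div 2 ^ j < q div 2 ^ j" by simp
  have half: "y div 2 ^ Suc j = y div 2 ^ j div 2" for y :: nat
    by (metis div_mult2_eq power_Suc2)
  have odd_succ: "b = 2 * (b div 2) + 1 \<and> a < 2 * (b div 2) + 1"
    if "a < b" "a div 2 = b div 2" for a b :: nat
    using that by presburger
  have "p div 2 ^ j div 2 = q div 2 ^ j div 2" using a half by simp
  with less have eq: "q div 2 ^ j = 2 * (q div 2 ^ Suc j) + 1" and p: "p div 2 ^ j < 2 * (q div 2 ^ Suc j) + 1"
    unfolding half using odd_succ by blast+
  show "midpoint j q \<le> q"
    unfolding midpoint_def eq[symmetric] by (simp add: div_times_less_eq_dividend)
  show "p < midpoint j q"
    using p unfolding midpoint_def by (simp add: div_less_iff_less_mult)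
qed

text \<open>
  The data structure consists of a header of six words, the table of vertex blocks, a table of binary
  logarithms, the table of home rows for all \<open>S1\<close> scales, one block for each of the \<open>T\<close> linear orders
  \<open>xs i\<close> (the positions of all vertices and then \<open>g\<close> entries for every position) and one block for
  each scale \<open>i\<close> (its \<open>Tl i\<close> rows of labels). Vertex \<open>u\<close> is good in the order \<open>s u\<close> and its ball of
  scale \<open>i\<close> is monochromatic in the labelling \<open>sc i u\<close>.
\<close>

locale packed_layout =
  fixes n g S1 R mode T :: nat and xs :: "nat \<Rightarrow> nat list" and s :: "nat \<Rightarrow> nat"
    and ent :: "nat \<Rightarrow> nat \<Rightarrow> nat \<Rightarrow> nat"
    and Tl :: "nat \<Rightarrow> nat" and sc :: "nat \<Rightarrow> nat \<Rightarrow> nat"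
    and slab :: "nat \<Rightarrow> nat \<Rightarrow> nat \<Rightarrow> nat"
  assumes n: "0 < n" "n \<le> 2 ^ g" and mode: "mode \<le> 1" and R: "R \<le> S1"
    and xs: "i < T \<Longrightarrow> distinct (xs i)" "i < T \<Longrightarrow> set (xs i) \<subseteq> {..<n}"
    and s: "u < n \<Longrightarrow> s u < T" "u < n \<Longrightarrow> i \<le> s u \<Longrightarrow> u \<in> set (xs i)"
    and ent: "i < T \<Longrightarrow> p < length (xs i) \<Longrightarrow> j < g \<Longrightarrow> ent i p j < n + S1"
    and slab: "i < S1 \<Longrightarrow> j < Tl i \<Longrightarrow> x < n \<Longrightarrow> slab i j x < n"
    and sc: "i < S1 \<Longrightarrow> u < n \<Longrightarrow> sc i u < Tl i"
begin

definition len :: "nat \<Rightarrow> nat" where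
  "len i = (if i = 0 then 6 else if i = 1 then n else if i = 2 then 2 ^ g else if i = 3 then S1 * n
     else if i < 4 + T then n + length (xs (i - 4)) * g else Tl (i - 4 - T) * n)"

abbreviation "start \<equiv> segment_start len"

text \<open>A vertex missing from the order gets the length of the order, a filler that still fits
  into a word.\<close>

definition position :: "nat \<Rightarrow> nat \<Rightarrow> nat" where
  "position i x = length (takeWhile (\<lambda>y. y \<noteq> x) (xs i))"

text \<open>The vertex table and the table of home rows hold absolute addresses, so the query
  reaches a block or a row of labels without knowing \<open>T\<close> or the block lengths.\<close>

definition cell :: "nat \<Rightarrow> nat \<Rightarrow> nat" where
  "cell i a = (if i = 0 then [mode, n, g, start 2, start 3, R] ! a
     else if i = 1 then start (4 + s a)
     else if i = 2 then floor_log a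
     else if i = 3 then start (4 + T + a div n) + sc (a div n) (a mod n) * n
     else if i < 4 + T then
       (if a < n then position (i - 4) a else ent (i - 4) ((a - n) div g) ((a - n) mod g))
     else slab (i - 4 - T) (a div n) (a mod n))"

definition data :: "nat list" where
  "data = segments (4 + T + S1) len cell"

text \<open>The factor 2 keeps the sum \<open>hi + lo\<close> of the binary search below
  \<open>2 ^ W\<close>, and 16 leaves room for the header addresses.\<close>

definition packed :: ram_oracle where
  "packed = \<lparr>query_prog = query_program,
     word_size = Suc (floor_log (2 * (n + length data + 16))), stored = data\<rparr>"

abbreviation "m \<equiv> stored_mem packed"
abbreviation "W \<equiv> word_size packed"

lemma word_size_large: "2 * (n + length data + 16) < 2 ^ W"
  using floor_log_exp2_gt[of "2 * (n + length data + 16)"] by (simp add: packed_def)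

lemma less_word: "a < length data \<Longrightarrow> a < 2 ^ W"
proof -
  have "length data \<le> 2 * (n + length data + 16)" by simp
  then show "a < length data \<Longrightarrow> a < 2 ^ W" using word_size_large by (meson less_le_trans less_trans)
qed

lemma length_data: "length data = start (4 + T + S1)"
  by (simp add: data_def length_segments)

lemma address_less: "i < 4 + T + S1 \<Longrightarrow> a < len i \<Longrightarrow> start i + a < length data"
  unfolding length_data by (rule segment_address_less)

lemma mem_cell: "i < 4 + T + S1 \<Longrightarrow> a < len i \<Longrightarrow> m (start i + a) = cell i a"
  using address_less[of i a] by (simp add: stored_mem_def packed_def data_def nth_segments)

lemma start_le: "i \<le> 4 + T + S1 \<Longrightarrow> start i \<le> length data"
  unfolding length_data by (rule segment_start_mono)

lemma start_0: "start 0 = 0" and start_1: "start 1 = 6"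
  by (simp_all add: segment_start_def len_def)

lemma mem_header: "a < 6 \<Longrightarrow> m a = [mode, n, g, start 2, start 3, R] ! a"
  using mem_cell[of 0 a] by (simp add: start_0 len_def cell_def)

lemma mem_vertex: "u < n \<Longrightarrow> m (6 + u) = start (4 + s u)"
  using mem_cell[of 1 u] by (simp add: start_1 len_def cell_def del: One_nat_def)

lemma mem_log: "x < 2 ^ g \<Longrightarrow> m (start 2 + x) = floor_log x"
  using mem_cell[of 2 x] by (simp add: len_def cell_def)

lemma mem_home:
  "i < S1 \<Longrightarrow> u < n \<Longrightarrow> m (i * n + start 3 + u) = start (4 + T + i) + sc i u * n"
  using mem_cell[of 3 "i * n + u"] row_index_less[of i S1 u n]
  by (simp add: len_def cell_def add_ac)

lemma mem_label:
  "i < S1 \<Longrightarrow> j < Tl i \<Longrightarrow> x < n \<Longrightarrow> m (start (4 + T + i) + j * n + x) = slab i j x"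
  using mem_cell[of "4 + T + i" "j * n + x"] row_index_less[of j "Tl i" x n]
  by (simp add: len_def cell_def add.assoc)

lemma mem_position: "i < T \<Longrightarrow> x < n \<Longrightarrow> m (start (4 + i) + x) = position i x"
  using mem_cell[of "4 + i" x] by (simp add: len_def cell_def)

lemma mem_entry:
  assumes "i < T" "p < length (xs i)" "j < g"
  shows "m (p * g + (start (4 + i) + n + j)) = ent i p j"
    "p * g + (start (4 + i) + n + j) < length data"
proof -
  have eq: "p * g + (start (4 + i) + n + j) = start (4 + i) + (n + (p * g + j))" by simp
  have lt: "n + (p * g + j) < len (4 + i)"
    using row_index_less[of p "length (xs i)" j g] assms by (simp add: len_def)
  then show "p * g + (start (4 + i) + n + j) < length data"
    unfolding eq using assms(1) by (intro address_less) auto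
  show "m (p * g + (start (4 + i) + n + j)) = ent i p j"
    unfolding eq using mem_cell[OF _ lt] assms by (simp add: cell_def)
qed

lemma position_correct:
  assumes "i < T" "x \<in> set (xs i)"
  shows "position i x < length (xs i)" "xs i ! position i x = x"
proof -
  show "position i x < length (xs i)"
  proof -
    have "x \<in> set ys \<Longrightarrow> length (takeWhile (\<lambda>y. y \<noteq> x) ys) < length ys" for ys
      by (induction ys) auto
    then show ?thesis using assms(2) by (simp add: position_def)
  qed
  then show "xs i ! position i x = x"
    using nth_length_takeWhile[of "\<lambda>y. y \<noteq> x" "xs i"] by (simp add: position_def)
qed

lemma length_xs_le: "i < T \<Longrightarrow> length (xs i) \<le> n"
  using xs[of i] card_mono[of "{..<n}" "set (xs i)"] by (simp add: distinct_card)

lemma xor_less_table: "p < n \<Longrightarrow> q < n \<Longrightarrow> Bit_Operations.xor p q < 2 ^ g"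
proof -
  assume "p < n" "q < n"
  then have "take_bit g p = p" "take_bit g q = q" using n by (simp_all add: take_bit_nat_eq_self_iff)
  then have "take_bit g (Bit_Operations.xor p q) = Bit_Operations.xor p q" by simp
  then show ?thesis by (simp only: take_bit_nat_eq_self_iff)
qed

lemma entry_lookup_packed:
  assumes uv: "u < n" "v < n" "u \<noteq> v" and i: "i = min (s u) (s v)"
    and p: "p = position i u" and q: "q = position i v" and j: "j = floor_log (Bit_Operations.xor p q)"
  shows "entry_lookup packed m u v W (start (4 + i)) n g (start 2) p q j (start (4 + i) + n + j)"
    and "i < T" "p < length (xs i)" "q < length (xs i)" "xs i ! p = u" "xs i ! q = v" "p \<noteq> q" "j < g"
proof -
  show iT: "i < T" using s(1)[OF uv(1)] i by simp
  have mem: "u \<in> set (xs i)" "v \<in> set (xs i)" using s(2)[OF uv(1)] s(2)[OF uv(2)] i by auto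
  show pl: "p < length (xs i)" and ql: "q < length (xs i)" and pu: "xs i ! p = u" and qv: "xs i ! q = v"
    using position_correct[OF iT] mem p q by auto
  show pq: "p \<noteq> q" using pu qv uv(3) by auto
  have x: "Bit_Operations.xor p q < 2 ^ g"
    using pl ql length_xs_le[OF iT] by (intro xor_less_table) auto
  have "Bit_Operations.xor p q \<noteq> 0" using pq xor_eq_zero_nat by blast
  then have "2 ^ j \<le> Bit_Operations.xor p q" using floor_log_exp2_le j by auto
  then have "2 ^ j < (2::nat) ^ g" using x by (rule le_less_trans)
  then show jg: "j < g" by simp
  \<comment> \<open>Blocks are stored in the order of their indices, so comparing addresses finds
    the smaller index.\<close>
  have tree: "min (start (4 + s u)) (start (4 + s v)) = start (4 + i)"
    using i segment_start_mono[of "4 + s u" "4 + s v" len] segment_start_mono[of "4 + s v" "4 + s u" len]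
    by (cases "s u \<le> s v") (auto simp: min_def)
  have addr: "start 1 + u < length data" "start 1 + v < length data"
    "start (4 + i) + u < length data" "start (4 + i) + v < length data"
    "start 2 + Bit_Operations.xor p q < length data"
    using uv iT x by (auto intro!: address_less simp: len_def)
  show "entry_lookup packed m u v W (start (4 + i)) n g (start 2) p q j (start (4 + i) + n + j)"
  proof
    show "query_prog packed = query_program" by (simp add: packed_def)
    show "min (m (6 + u)) (m (6 + v)) = start (4 + i)" using mem_vertex uv tree by simp
    show "m 1 = n" "m 2 = g" "m 3 = start 2" by (simp_all add: mem_header)
    show "m (start (4 + i) + u) = p" "m (start (4 + i) + v) = q" using mem_position iT uv p q by auto
    show "m (Bit_Operations.xor p q + start 2) = j"
      using mem_log[OF x] j by (simp add: add.commute)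
    show "p * g + (start (4 + i) + n + j) < 2 ^ W"
      using mem_entry(2)[OF iT pl jg] by (rule less_word)
    show "(6::nat) < 2 ^ W" using word_size_large by simp
    show "6 + u < 2 ^ W" "6 + v < 2 ^ W" using addr(1,2) start_1 less_word by auto
    show "start (4 + i) + u < 2 ^ W" "start (4 + i) + v < 2 ^ W"
      "Bit_Operations.xor p q + start 2 < 2 ^ W"
      using addr(3-5) less_word by (auto simp: add.commute)
  qed (use uv in auto)
qed

lemma answer_direct_packed:
  assumes uv: "u < n" "v < n" "u \<noteq> v" and i: "i = min (s u) (s v)"
    and p: "p = position i u" and q: "q = position i v" and j: "j = floor_log (Bit_Operations.xor p q)"
    and mode: "mode = 0"
  shows "\<exists>t\<le>40. answers_in packed u v (via u (ent i p j) v) t"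
proof -
  note L = entry_lookup_packed[OF uv i p q j]
  interpret Q: entry_lookup packed m u v W "start (4 + i)" n g "start 2" p q j "start (4 + i) + n + j"
    by (rule L(1))
  have "m 0 = 0" using mem_header[of 0] mode by simp
  from Q.answer_direct[OF this] show ?thesis unfolding mem_entry(1)[OF L(2,3,8)] .
qed

lemma answer_by_search_packed:
  assumes uv: "u < n" "v < n" "u \<noteq> v" and i: "i = min (s u) (s v)"
    and p: "p = position i u" and q: "q = position i v" and j: "j = floor_log (Bit_Operations.xor p q)"
    and mode: "mode = 1"
    and hi: "hi = max (ent i p j) (ent i q j)" "0 < hi" "hi < S1" and R: "0 < R" "R \<le> 2 ^ a"
    and test_hi: "slab hi (sc hi u) u = slab hi (sc hi u) v"
  shows "\<exists>t \<le> 16 * a + 60. \<exists>h. hi - R < h \<and> h \<le> hi \<and> slab h (sc h u) u = slab h (sc h u) v \<and>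
    (h = Suc (hi - R) \<or> slab (h - 1) (sc (h - 1) u) u \<noteq> slab (h - 1) (sc (h - 1) u) v) \<and>
    answers_in packed u v (via u (slab h (sc h u) u) v) t"
proof -
  note L = entry_lookup_packed[OF uv i p q j]
  interpret Q: entry_lookup packed m u v W "start (4 + i)" n g "start 2" p q j "start (4 + i) + n + j"
    by (rule L(1))
  let ?S = "S1 - 1"
  have h: "m 0 = 1" "m 4 = start 3" "m 5 = R" using mem_header[of 0] mem_header[of 4] mem_header[of 5] mode by simp_all
  have row: "m (m (i * n + start 3 + u) + x) = slab i (sc i u) x" if "i < S1" "x < n" for i x
    using that mem_home[of i u] mem_label[of i "sc i u" x] sc[of i u] uv by simp
  have "start 3 + (i * n + u) < length data" if "i < S1" for i
    using row_index_less[of i S1 u n] that uv by (intro address_less) (auto simp: len_def)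
  then have a1: "i * n + start 3 + u < 2 ^ W" if "i \<le> ?S" for i
    using that hi(3) less_word by (simp add: add_ac)
  have "start (4 + T + i) + (sc i u * n + x) < length data" if "i < S1" "x < n" for i x
    using row_index_less[of "sc i u" "Tl i" x n] that uv sc[of i u]
    by (intro address_less) (auto simp: len_def)
  then have a2: "m (i * n + start 3 + u) + x < 2 ^ W" if "i \<le> ?S" "x < n" for i x
    using that hi(3) mem_home[of i u] uv less_word by (simp add: add.assoc)
  \<comment> \<open>The table of home rows alone has \<open>S1 * n\<close> cells, so scale indices
    are below the length of the data.\<close>
  have "S1 * n \<le> length data"
    using start_le[of 4] by (simp add: segment_start_def len_def eval_nat_numeral)
  moreover have "S1 \<le> S1 * n" using n by simp
  ultimately have "S1 \<le> length data" by (rule le_trans[rotated])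
  then have "2 * ?S \<le> 2 * (n + length data + 16)" by simp
  then have S: "2 * ?S < 2 ^ W" using word_size_large by (rule le_less_trans)
  have e2: "q * g + (start (4 + i) + n + j) < 2 ^ W"
    using mem_entry(2)[OF L(2,4,8)] by (rule less_word)
  have max: "max (m (p * g + (start (4 + i) + n + j))) (m (q * g + (start (4 + i) + n + j))) = hi"
    unfolding mem_entry(1)[OF L(2,3,8)] mem_entry(1)[OF L(2,4,8)] by (simp add: hi(1))
  have hiS: "hi \<le> ?S" using hi(3) by simp
  have test: "m (m (hi * n + start 3 + u) + u) = m (m (hi * n + start 3 + u) + v)"
    using row[OF hi(3)] uv test_hi by simp
  from Q.answer_by_search[OF h R(1) e2 max hi(2) hiS R(2) test S a1 a2[OF _ uv(1)] a2[OF _ uv(2)]]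
  obtain t h where t: "t \<le> 16 * a + 60" "hi - R < h" "h \<le> hi"
    "m (m (h * n + start 3 + u) + u) = m (m (h * n + start 3 + u) + v)"
    "h = Suc (hi - R) \<or> m (m ((h - 1) * n + start 3 + u) + u) \<noteq> m (m ((h - 1) * n + start 3 + u) + v)"
    "answers_in packed u v (via u (m (m (h * n + start 3 + u) + u)) v) t" by blast
  have "h < S1" "h - 1 < S1" using t(3) hi(3) by auto
  with t row uv show ?thesis by (intro exI[of _ t] conjI exI[of _ h]) auto
qed

lemma answer_same_packed: "answers_in packed u u [u] 4"
  by (rule answer_equal_vertices) (simp_all add: packed_def)

lemma length_data_eq:
  "length data = 6 + n + 2 ^ g + S1 * n + (\<Sum>i<T. n + length (xs i) * g) + (\<Sum>i<S1. Tl i * n)"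
proof -
  have "length data = (\<Sum>j<4. len j) + (\<Sum>i<T. len (4 + i)) + (\<Sum>i<S1. len (4 + T + i))"
    by (simp add: length_data segment_start_def sum_lessThan_add)
  also have "(\<Sum>j<4. len j) = 6 + n + 2 ^ g + S1 * n"
    by (simp add: len_def eval_nat_numeral)
  also have "(\<Sum>i<T. len (4 + i)) = (\<Sum>i<T. n + length (xs i) * g)"
    by (intro sum.cong) (auto simp: len_def)
  also have "(\<Sum>i<S1. len (4 + T + i)) = (\<Sum>i<S1. Tl i * n)"
    by (intro sum.cong) (auto simp: len_def)
  finally show ?thesis .
qed

text \<open>A cell holds a header constant, an address, a logarithm, a position, a vertex or a scale
  index. Constants and scale indices are covered because the data contain tables of sizes
  \<open>2 ^ g\<close> and \<open>S1 * n\<close>.\<close>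

lemma cell_bound:
  assumes i: "i < 4 + T + S1" and a: "a < len i"
  shows "cell i a \<le> n + length data"
proof -
  have S1: "S1 \<le> S1 * n" using n by simp
  have g: "g < 2 ^ g" by simp
  have total: "2 ^ g + S1 * n \<le> length data" "0 < length data"
    unfolding length_data_eq by linarith+
  consider "i = 0" | "i = 1" | "i = 2" | "i = 3" | "4 \<le> i" "i < 4 + T" | "4 + T \<le> i" by linarith
  then show ?thesis
  proof cases
    case 1
    then have "a \<in> {0, 1, 2, 3, 4, 5}" using a by (auto simp: len_def)
    moreover have "start 2 \<le> length data" "start 3 \<le> length data" by (auto intro: start_le)
    moreover have "mode \<le> n + length data" "g \<le> n + length data" "R \<le> n + length data"
      using mode R S1 g total n by linarith+
    ultimately show ?thesis using 1 by (auto simp: cell_def)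
  next
    case 2
    then have "s a < T" using a s(1) by (simp add: len_def)
    then show ?thesis using 2 start_le[of "4 + s a"] by (simp add: cell_def)
  next
    case 3
    then have a: "a < 2 ^ g" using a by (simp add: len_def)
    have "floor_log a \<le> floor_log (2 ^ g)" using a by (intro floor_log_le_iff) simp
    then have "floor_log a \<le> g" by simp
    then have "floor_log a \<le> n + length data" using g total by linarith
    then show ?thesis using 3 by (simp add: cell_def)
  next
    case 4
    then have a: "a < S1 * n" using a by (simp add: len_def)
    then have "a div n < S1" "a mod n < n" using n by (auto simp: div_less_iff_less_mult)
    then have "start (4 + T + a div n) + (sc (a div n) (a mod n) * n + 0) < length data"
      using row_index_less[of "sc (a div n) (a mod n)" "Tl (a div n)" 0 n] sc n
      by (intro address_less) (auto simp: len_def)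
    then show ?thesis using 4 by (simp add: cell_def)
  next
    case 5
    define i' where "i' = i - 4"
    have i': "i' < T" using 5 by (auto simp: i'_def)
    show ?thesis
    proof (cases "a < n")
      case True
      have "position i' a \<le> length (xs i')" unfolding position_def by (rule length_takeWhile_le)
      then show ?thesis using 5 True length_xs_le[OF i'] by (simp add: cell_def i'_def)
    next
      case False
      then have "a - n < length (xs i') * g" using a 5 by (auto simp: len_def i'_def)
      moreover from this have "0 < g" by (cases g) auto
      ultimately have "(a - n) div g < length (xs i')" "(a - n) mod g < g"
        by (auto simp: div_less_iff_less_mult)
      then have "ent i' ((a - n) div g) ((a - n) mod g) < n + S1" using ent i' by blast
      then have "ent i' ((a - n) div g) ((a - n) mod g) \<le> n + length data"
        using S1 total by linarith
      then show ?thesis using 5 False by (simp add: cell_def i'_def)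
    qed
  next
    case 6
    define i' where "i' = i - 4 - T"
    have i': "i' < S1" "len i = Tl i' * n" using 6 i by (auto simp: i'_def len_def)
    then have "a div n < Tl i'" "a mod n < n" using a n by (auto simp: div_less_iff_less_mult)
    then have "slab i' (a div n) (a mod n) < n" using slab i' by blast
    then show ?thesis using 6 by (simp add: cell_def i'_def)
  qed
qed

lemma oracle_fits_packed: "oracle_fits 6 n packed"
proof -
  let ?N = "n + length data + 2"
  have st: "stored packed = data" by (simp add: packed_def)
  have "x < 2 ^ W" if "x \<in> set data" for x
    using that cell_bound word_size_large unfolding data_def set_segments by force
  moreover have "real W \<le> 6 * log 2 (real ?N)"
  proof -
    have "(2::nat) ^ (W - 1) \<le> 2 * (n + length data + 16)"
      using floor_log_exp2_le[of "2 * (n + length data + 16)"] by (simp add: packed_def)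
    \<comment> \<open>The factor 16 costs four bits and the \<open>Suc\<close> in the word size one
      more; since \<open>log 2 ?N\<close> is at least 1, a factor 6 absorbs these five.\<close>
    also have "\<dots> \<le> 16 * ?N" by simp
    finally have "(2::nat) ^ (W - 1) \<le> 16 * ?N" .
    then have "real (2 ^ (W - 1)) \<le> real (16 * ?N)" by (rule of_nat_mono)
    then have "2 powr real (W - 1) \<le> 16 * real ?N" by (simp add: powr_realpow)
    then have "real (W - 1) \<le> log 2 (16 * real ?N)" by (subst le_log_iff) auto
    also have "\<dots> = 4 + log 2 ?N"
      using log_mult[of 2 16 "real ?N"] log_pow_cancel[of 2 4] by simp
    finally have "real W \<le> 5 + log 2 ?N" by (simp add: packed_def)
    moreover have "1 \<le> log 2 ?N" by (subst le_log_iff) auto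
    ultimately show ?thesis by linarith
  qed
  ultimately show ?thesis
    using word_size_large unfolding oracle_fits_def st by (auto simp: add_ac)
qed

end

section \<open>The two emulators\<close>

lemma aspect_ratio_bounds:
  fixes G :: "'a pair_pre_digraph"
  assumes G: "weighted_graph G w" "connected (with_proj G)" and card: "2 \<le> card (pverts G)"
  obtains m M where "0 < m" "m \<le> M" "aspect_ratio G w = M / m"
    "\<And>u v. u \<in> pverts G \<Longrightarrow> v \<in> pverts G \<Longrightarrow> u \<noteq> v \<Longrightarrow> m \<le> rdist G w u v"
    "\<And>u v. u \<in> pverts G \<Longrightarrow> v \<in> pverts G \<Longrightarrow> rdist G w u v \<le> M"
proof -
  interpret finite_metric "pverts G" "rdist G w" by (rule finite_metric_rdist[OF G])
  have gd: "gdist G w u v = ereal (rdist G w u v)" if "u \<in> pverts G" "v \<in> pverts G" for u v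
    by (rule gdist_eq_rdist[OF G that])
  define A where "A = {gdist G w u v | u v. u \<in> pverts G \<and> v \<in> pverts G}"
  define B where "B = {gdist G w u v | u v. u \<in> pverts G \<and> v \<in> pverts G \<and> u \<noteq> v}"
  have "A = (\<lambda>(u, v). gdist G w u v) ` (pverts G \<times> pverts G)" by (auto simp: A_def)
  then have fA: "finite A" using finite_V by simp
  have BA: "B \<subseteq> A" by (auto simp: A_def B_def)
  then have fB: "finite B" using fA finite_subset by blast
  obtain a b where ab: "a \<in> pverts G" "b \<in> pverts G" "a \<noteq> b"
    using card by (metis card_2_iff' card_le_Suc0_iff_eq finite_V not_less_eq_eq numeral_2_eq_2)
  have "B \<noteq> {}" using ab by (auto simp: B_def)
  then have "Min B \<in> B" "Max A \<in> A" using fA fB BA by (auto intro: Min_in Max_in)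
  then obtain u v u' v' where min: "Min B = ereal (rdist G w u v)" "u \<in> pverts G" "v \<in> pverts G" "u \<noteq> v"
    and max: "Max A = ereal (rdist G w u' v')" "u' \<in> pverts G" "v' \<in> pverts G"
    using gd by (auto simp: A_def B_def)
  show thesis
  proof
    show pos: "0 < rdist G w u v" using d_pos min by blast
    show lower: "rdist G w u v \<le> rdist G w x y" if "x \<in> pverts G" "y \<in> pverts G" "x \<noteq> y" for x y
    proof -
      have "gdist G w x y \<in> B" using that by (auto simp: B_def)
      then have "Min B \<le> gdist G w x y" using fB by simp
      then show ?thesis using min(1) gd[OF that(1,2)] by (metis ereal_less_eq(3))
    qed
    show upper: "rdist G w x y \<le> rdist G w u' v'" if "x \<in> pverts G" "y \<in> pverts G" for x y
    proof -
      have "gdist G w x y \<in> A" using that by (auto simp: A_def)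
      then have "gdist G w x y \<le> Max A" using fA by simp
      then show ?thesis using max(1) gd[OF that] by (metis ereal_less_eq(3))
    qed
    show "rdist G w u v \<le> rdist G w u' v'" using upper min by blast
    show "aspect_ratio G w = rdist G w u' v' / rdist G w u v"
      using card pos min(1) max(1) unfolding aspect_ratio_def A_def[symmetric] B_def[symmetric]
      by simp
  qed
qed

text \<open>The dyadic midpoint lies between the two positions, so the Ramsey property applies to
  it; the case \<open>q < p\<close> follows by symmetry of \<open>d\<close>.\<close>

lemma (in finite_metric) ramsey_midpoint:
  assumes r: "ramsey_order c ys U" and U: "u \<in> U \<or> v \<in> U" and V: "set ys \<subseteq> V"
    and p: "p < length ys" "ys ! p = u" and q: "q < length ys" "ys ! q = v" and "p \<noteq> q"
    and j: "j = floor_log (Bit_Operations.xor p q)"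
  shows "midpoint j p = midpoint j q" "midpoint j p < length ys"
    "d u (ys ! midpoint j p) \<le> c * d u v" "d (ys ! midpoint j p) v \<le> c * d u v"
proof -
  have "midpoint j p = midpoint j q \<and> midpoint j p < length ys \<and>
    d u (ys ! midpoint j p) \<le> c * d u v \<and> d (ys ! midpoint j p) v \<le> c * d u v"
  proof (cases "p < q")
    case True
    note z = midpoint_between[OF True j]
    then have "p \<le> midpoint j p" "midpoint j p \<le> q" by auto
    then show ?thesis using z(1) r U p q unfolding ramsey_order_def by auto
  next
    case False
    then have qp: "q < p" using assms(8) by simp
    have "j = floor_log (Bit_Operations.xor q p)" using j by (simp add: xor.commute)
    note z = midpoint_between[OF qp this]
    then have mid: "q \<le> midpoint j p" "midpoint j p \<le> p" by auto
    have "d v (ys ! midpoint j p) \<le> c * d v u \<and> d (ys ! midpoint j p) u \<le> c * d v u"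
      using mid r U p q unfolding ramsey_order_def by auto
    moreover have "u \<in> V" "v \<in> V" "ys ! midpoint j p \<in> V"
      using V p q mid by (auto simp: subset_iff)
    ultimately show ?thesis using z mid p d_sym by (metis le_less_trans)
  qed
  then show "midpoint j p = midpoint j q" "midpoint j p < length ys"
    "d u (ys ! midpoint j p) \<le> c * d u v" "d (ys ! midpoint j p) v \<le> c * d u v" by auto
qed

lemma ln_2_ge_half: "1 / 2 \<le> ln (2::real)"
  using ln_le_minus_one[of "1 / 2"] by (simp add: ln_div)

text \<open>With \<open>\<sigma> = root (2 * k) n\<close> one has
  \<open>ln n = 2k * ln \<sigma> \<le> 2k * (\<sigma> - 1)\<close>. Passing to base 2 costs another
  factor 2, and the subtracted term pays for the \<open>Suc\<close>.\<close>

lemma level_bound: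
  assumes "0 < n" "1 \<le> k"
  shows "real (Suc (floor_log n)) \<le> 4 * real k * root (2 * k) n"
proof -
  define \<sigma> where "\<sigma> = root (2 * k) (real n)"
  have \<sigma>: "1 \<le> \<sigma>" "\<sigma> ^ (2 * k) = n" using assms by (auto simp: \<sigma>_def)
  have "real (2 ^ floor_log n) \<le> real n"
    using floor_log_exp2_le[OF assms(1)] of_nat_le_iff by blast
  then have "ln (2 ^ floor_log n) \<le> ln (\<sigma> ^ (2 * k))"
    using \<sigma> assms(1) by (subst ln_le_cancel_iff) auto
  then have "real (floor_log n) * ln 2 \<le> 2 * real k * ln \<sigma>"
    using \<sigma>(1) by (simp add: ln_realpow)
  also have "\<dots> \<le> 2 * real k * (\<sigma> - 1)"
    using \<sigma>(1) by (intro mult_left_mono ln_le_minus_one) auto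
  finally have "real (floor_log n) * ln 2 \<le> 2 * real k * (\<sigma> - 1)" .
  moreover have "real (floor_log n) * (1 / 2) \<le> real (floor_log n) * ln 2"
    using ln_2_ge_half by (intro mult_left_mono) auto
  ultimately have "real (floor_log n) \<le> 4 * real k * (\<sigma> - 1)" by simp
  moreover have "1 \<le> real k" using assms(2) by simp
  ultimately show ?thesis unfolding \<sigma>_def[symmetric] by (simp add: algebra_simps)
qed

lemma root_twice:
  assumes "1 \<le> k"
  shows "root (2 * k) (real n) * root (2 * k) n = root k n" "root (2 * k) (real n) \<le> root k n"
proof -
  have "(root (2 * k) (real n)) ^ 2 = root k n"
    unfolding real_root_mult_exp using assms by (intro real_root_pow_pos2) auto
  then show eq: "root (2 * k) (real n) * root (2 * k) n = root k n" by (simp add: power2_eq_square)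
  show "root (2 * k) (real n) \<le> root k n"
  proof (cases "n = 0")
    case False
    then have "1 \<le> root (2 * k) (real n)" using assms by simp
    then have "root (2 * k) (real n) * 1 \<le> root (2 * k) (real n) * root (2 * k) n"
      by (intro mult_left_mono) auto
    then show ?thesis using eq by simp
  qed simp
qed

lemma root_times:
  assumes "1 \<le> k" "0 < n"
  shows "root k (real n) * n = real n powr (1 + 1 / real k)"
  using assms by (simp add: root_powr_inverse powr_add)

text \<open>This is why the orders are built with parameter \<open>2 * k\<close>: one factor
  \<open>root (2 * k) n\<close> pays for their total length and a second one for the logarithmic
  number of entries per position.\<close>

lemma entries_bound:
  assumes k: "1 \<le> k" and n: "0 < n"
    and sum: "(\<Sum>i<T. real (l i)) \<le> root (2 * k) (real n) * n"
  shows "(\<Sum>i<T. real (l i * Suc (floor_log n))) \<le> 4 * (real k * real n powr (1 + 1 / real k))"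
proof -
  have "(\<Sum>i<T. real (l i * Suc (floor_log n))) = (\<Sum>i<T. real (l i)) * real (Suc (floor_log n))"
    by (simp only: sum_distrib_right of_nat_mult)
  also have "\<dots> \<le> (root (2 * k) (real n) * n) * (4 * real k * root (2 * k) n)"
    using level_bound[OF n k] sum k by (intro mult_mono) auto
  also have "\<dots> = 4 * (real k * (root (2 * k) (real n) * root (2 * k) n * n))" by simp
  also have "\<dots> = 4 * (real k * real n powr (1 + 1 / real k))"
    unfolding root_twice[OF k] root_times[OF k n] ..
  finally show ?thesis .
qed

lemma (in packed_layout) length_data_le:
  assumes k: "1 \<le> k" and g: "g = Suc (floor_log n)"
    and T: "real T \<le> real (2 * k) * root (2 * k) n"
    and sum: "(\<Sum>i<T. real (length (xs i))) \<le> root (2 * k) (real n) * n"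
    and Tl: "\<And>i. i < S1 \<Longrightarrow> real (Tl i) \<le> k * root k n"
  shows "real (length data) \<le> (15 + 2 * real S1) * (real k * real n powr (1 + 1 / real k))"
proof -
  define B where "B = real k * real n powr (1 + 1 / real k)"
  have B: "B = real k * (root k (real n) * n)" by (simp add: B_def root_times[OF k n(1)])
  have "1 \<le> root k (real n)" using n k by simp
  then have "1 * 1 \<le> real k * root k (real n)" using k by (intro mult_mono) auto
  then have "1 * real n \<le> real k * root k (real n) * n" by (intro mult_right_mono) auto
  then have nB: "real n \<le> B" by (simp add: B)
  then have oneB: "1 \<le> B" using n by linarith
  have "real (2 ^ g) \<le> real (2 * n)"
    using floor_log_exp2_le[OF n(1)] by (intro of_nat_mono) (simp add: g)
  then have 1: "real (2 ^ g) \<le> 2 * B" using nB by simp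
  have 2: "real (S1 * n) \<le> S1 * B" using nB by (simp add: mult_left_mono)
  have "real (T * n) \<le> (real (2 * k) * root (2 * k) n) * n"
    using T by (simp only: of_nat_mult mult_right_mono of_nat_0_le_iff)
  also have "\<dots> \<le> (real (2 * k) * root k n) * n"
    using root_twice(2)[OF k] by (intro mult_right_mono mult_left_mono) auto
  finally have 3: "real (T * n) \<le> 2 * B" by (simp add: B)
  have "(\<Sum>i<T. real (length (xs i) * g)) \<le> 4 * B"
    using entries_bound[OF k n(1) sum] by (simp add: g B_def)
  then have 4: "real (\<Sum>i<T. n + length (xs i) * g) \<le> 6 * B"
    using 3 by (simp add: sum.distrib)
  have "real (\<Sum>i<S1. Tl i * n) = (\<Sum>i<S1. real (Tl i) * n)" by simp
  also have "\<dots> \<le> (\<Sum>i<S1. B)"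
  proof (rule sum_mono)
    fix i assume "i \<in> {..<S1}"
    then have "real (Tl i) * n \<le> (k * root k n) * n" using Tl by (intro mult_right_mono) auto
    then show "real (Tl i) * n \<le> B" by (simp add: B)
  qed
  finally have 5: "real (\<Sum>i<S1. Tl i * n) \<le> S1 * B" by simp
  have "real (length data) = 6 + real n + real (2 ^ g) + real (S1 * n) +
      real (\<Sum>i<T. n + length (xs i) * g) + real (\<Sum>i<S1. Tl i * n)"
    unfolding length_data_eq by (simp only: of_nat_add of_nat_numeral)
  \<comment> \<open>In this order: header, vertex table, logarithms, home rows, order blocks
    (\<open>2 * B\<close> for positions and \<open>4 * B\<close> for entries), labels.\<close>
  also have "\<dots> \<le> 6 * B + B + 2 * B + S1 * B + 6 * B + S1 * B"
    using oneB nB 1 2 4 5 by linarith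
  also have "\<dots> = (15 + 2 * real S1) * B" by (simp add: algebra_simps)
  finally show ?thesis by (simp add: B_def)
qed

section \<open>Large stretch: the midpoint as the middle vertex\<close>

text \<open>Orders with parameter \<open>2 * k\<close> bound each hop by
  \<open>32 * k * d u v\<close>, hence 64. For \<open>n = 1\<close> there are no distinct pairs, and
  any stretch will do.\<close>

lemma direct_emulator:
  fixes G :: "nat pair_pre_digraph"
  assumes G: "weighted_graph G w" "connected (with_proj G)" "pverts G = {..<n}"
    and n: "0 < n" and k: "1 \<le> k" and \<alpha>: "64 * real k \<le> \<alpha> \<or> n = 1"
    and T0: "\<And>l. 40 \<le> T0 l"
  shows "\<exists>H w' D. query_prog D = query_program \<and> oracle_fits 6 n D \<and>
    interactive_emulator \<alpha> G w H w' D T0 \<and>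
    real (emulator_size H D) \<le> 15 * (real k * real n powr (1 + 1 / real k))"
proof -
  define d where "d = rdist G w"
  interpret finite_metric "{..<n}" d
    using finite_metric_rdist[OF G(1,2)] by (simp add: d_def G(3))
  obtain T xs s where T: "real T \<le> real (2 * k) * root (2 * k) n"
    "(\<Sum>i<T. real (length (xs i))) \<le> root (2 * k) (real n) * n"
    "\<forall>i<T. distinct (xs i) \<and> set (xs i) \<subseteq> {..<n}"
    "\<forall>u\<in>{..<n}. s u < T \<and> (\<forall>i \<le> s u. u \<in> set (xs i))"
    "\<forall>u\<in>{..<n}. \<exists>U. u \<in> U \<and> ramsey_order (16 * real (2 * k)) (xs (s u)) U"
    using ramsey_orders_exist[of "2 * k"] k by auto
  define g where "g = Suc (floor_log n)"
  \<comment> \<open>A midpoint beyond the end of the order gets the filler vertex 0.\<close>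
  define ent where "ent i p j = (if midpoint j p < length (xs i) then xs i ! midpoint j p else 0)"
    for i p j
  have ent_less: "ent i p j < n" if "i < T" for i p j
  proof (cases "midpoint j p < length (xs i)")
    case True
    then have "xs i ! midpoint j p \<in> set (xs i)" by simp
    moreover have "set (xs i) \<subseteq> {..<n}" using T(3) that by blast
    ultimately have "xs i ! midpoint j p \<in> {..<n}" by blast
    then show ?thesis using True by (simp add: ent_def)
  qed (simp add: ent_def n)
  have "n \<le> 2 ^ g" using floor_log_exp2_ge[of n] by (simp add: g_def)
  then interpret packed_layout n g 0 0 0 T xs s ent "\<lambda>_. 0" "\<lambda>_ _. 0" "\<lambda>_ _ _. 0"
    using n T(3,4) ent_less by unfold_locales (auto simp: trans_less_add1)
  \<comment> \<open>Every vertex is joined to all its entries, so the edges obey the same bound as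
    the stored entries.\<close>
  define F where "F = (\<lambda>(i, p, j). (xs i ! p, ent i p j)) `
    (SIGMA i:{..<T}. {..<length (xs i)} \<times> {..<g})"
  have "card F \<le> (\<Sum>i<T. length (xs i) * g)"
    unfolding F_def by (rule order_trans[OF card_image_le]) (auto simp: card_SigmaI)
  then have "real (card F) \<le> (\<Sum>i<T. real (length (xs i) * g))"
    by (metis of_nat_le_iff of_nat_sum)
  then have cF: "real (card F) \<le> 4 * (real k * real n powr (1 + 1 / real k))"
    using entries_bound[OF k n(1) T(2)] by (simp only: g_def)
  have fF: "finite F" unfolding F_def by auto
  have "interactive_emulator \<alpha> G w (metric_graph {..<n} F) (\<lambda>(x, y). d x y) packed T0"
    unfolding d_def G(3)[symmetric]
  proof (rule interactive_emulatorI[OF G(1,2), where b = 40])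
    show "40 \<le> T0 l" for l by (rule T0)
    show "\<exists>t. answers_in packed u u [u] t \<and> real t \<le> 40" for u
      using answer_same_packed[of u] by (intro exI[of _ 4]) simp
    fix u v assume "u \<in> pverts G" "v \<in> pverts G" and uv: "u \<noteq> v"
    then have u: "u < n" and v: "v < n" by (auto simp: G(3))
    have \<alpha>: "64 * real k \<le> \<alpha>" using \<alpha> u v uv by auto
    define i where "i = min (s u) (s v)"
    define p where "p = position i u"
    define q where "q = position i v"
    define j where "j = floor_log (Bit_Operations.xor p q)"
    note L = entry_lookup_packed[OF u v uv i_def p_def q_def j_def]
    define c where "c = ent i p j"
    have "s u = i \<or> s v = i" by (auto simp: i_def min_def)
    then obtain U where U: "u \<in> U \<or> v \<in> U" "ramsey_order (16 * real (2 * k)) (xs i) U"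
      using T(5) u v by blast
    have V: "set (xs i) \<subseteq> {..<n}" using T(3) L(2) by blast
    note M = ramsey_midpoint[OF U(2,1) V L(3,5,4,6,7) j_def]
    \<comment> \<open>The entries of both positions at level \<open>j\<close> coincide, so
      \<open>c\<close> is adjacent to \<open>u\<close> and to \<open>v\<close>.\<close>
    have c: "c = xs i ! midpoint j p" "c = ent i q j" using M(1,2) by (simp_all add: c_def ent_def)
    have "d u c + d c v \<le> 64 * real k * d u v" using M(3,4) c(1) by simp
    also have "\<dots> \<le> \<alpha> * d u v" using \<alpha> d_nonneg u v by (intro mult_right_mono) auto
    finally have "d u c + d c v \<le> \<alpha> * d u v" .
    moreover have "(u, c) \<in> F"
      unfolding F_def using L c_def by (intro image_eqI[of _ _ "(i, p, j)"]) auto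
    moreover have "(v, c) \<in> F"
      unfolding F_def using L c(2) by (intro image_eqI[of _ _ "(i, q, j)"]) auto
    moreover have "c < n" unfolding c_def using ent_less L(2) .
    moreover obtain t where "t \<le> 40" "answers_in packed u v (via u c v) t"
      using answer_direct_packed[OF u v uv i_def p_def q_def j_def refl] c_def by blast
    ultimately show "\<exists>c\<in>pverts G. (c = u \<or> (u, c) \<in> F \<or> (c, u) \<in> F) \<and>
      (c = v \<or> (v, c) \<in> F \<or> (c, v) \<in> F) \<and> rdist G w u c + rdist G w c v \<le> \<alpha> * rdist G w u v \<and>
      (\<exists>t. answers_in packed u v (via u c v) t \<and> real t \<le> 40)"
      by (intro bexI[of _ c]) (auto simp: d_def G(3))
  qed
  moreover have "real (emulator_size (metric_graph {..<n} F) packed) \<le>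
      15 * (real k * real n powr (1 + 1 / real k))"
  proof -
    have "real (length data) \<le> (15 + 2 * real 0) * (real k * real n powr (1 + 1 / real k))"
      using T(1,2) by (intro length_data_le[OF k g_def]) auto
    moreover have "real (card (edge_set (metric_graph {..<n} F))) \<le> real (card F)"
      using card_edge_set_metric_graph[OF fF] by simp
    moreover have "0 \<le> real k * real n powr (1 + 1 / real k)" by simp
    ultimately show ?thesis
      using cF unfolding emulator_size_def packed_def by (simp add: max_def)
  qed
  moreover have "query_prog packed = query_program" by (simp add: packed_def)
  ultimately show ?thesis using oracle_fits_packed by blast
qed

section \<open>Small stretch: binary search over geometric scales\<close>

lemma log_scales:
  assumes "1 < (b::real)" "1 \<le> x"
  shows "x \<le> b ^ nat \<lceil>ln x / ln b\<rceil>" "real (nat \<lceil>ln x / ln b\<rceil>) \<le> ln x / ln b + 1"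
proof -
  have nn: "0 \<le> ln x / ln b" using assms by simp
  show "real (nat \<lceil>ln x / ln b\<rceil>) \<le> ln x / ln b + 1" using nn by linarith
  have "ln x = ln x / ln b * ln b" using assms by simp
  also have "\<dots> \<le> real (nat \<lceil>ln x / ln b\<rceil>) * ln b"
    using assms by (intro mult_right_mono) (auto simp: real_nat_ceiling_ge)
  also have "\<dots> = ln (b ^ nat \<lceil>ln x / ln b\<rceil>)" using assms by (simp add: ln_realpow)
  finally show "x \<le> b ^ nat \<lceil>ln x / ln b\<rceil>" using assms by (subst (asm) ln_le_cancel_iff) auto
qed

text \<open>
  Scale \<open>S\<close> covers every pair, so capping the index there keeps the number of scales
  proportional to the logarithm of the aspect ratio alone.
\<close>

definition scale_index :: "nat \<Rightarrow> (nat \<Rightarrow> real) \<Rightarrow> real \<Rightarrow> nat" where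
  "scale_index S r y = (LEAST i. 1 \<le> i \<and> (i = S \<or> y \<le> r i))"

lemma scale_index:
  assumes "1 \<le> S"
  shows "1 \<le> scale_index S r y" "scale_index S r y \<le> S"
    "scale_index S r y = S \<or> y \<le> r (scale_index S r y)"
    "1 \<le> i \<Longrightarrow> i < scale_index S r y \<Longrightarrow> r i < y"
proof -
  have "1 \<le> S \<and> (S = S \<or> y \<le> r S)" using assms by simp
  from LeastI[of "\<lambda>i. 1 \<le> i \<and> (i = S \<or> y \<le> r i)", OF this]
    Least_le[of "\<lambda>i. 1 \<le> i \<and> (i = S \<or> y \<le> r i)", OF this]
  show *: "1 \<le> scale_index S r y" "scale_index S r y \<le> S"
    "scale_index S r y = S \<or> y \<le> r (scale_index S r y)"
    by (auto simp: scale_index_def)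
  show "1 \<le> i \<Longrightarrow> i < scale_index S r y \<Longrightarrow> r i < y"
    using not_less_Least[of i "\<lambda>i. 1 \<le> i \<and> (i = S \<or> y \<le> r i)"]
    by (auto simp: scale_index_def)
qed

text \<open>The entries locate \<open>d u v\<close> up to the factor \<open>64 * k\<close>, that is,
  within about \<open>e\<close> scales of ratio \<open>b\<close>, and \<open>a\<close> halvings
  search this window.\<close>

lemma search_emulator:
  fixes G :: "nat pair_pre_digraph"
  assumes G: "weighted_graph G w" "connected (with_proj G)" "pverts G = {..<n}"
    and n: "2 \<le> n" and k: "1 \<le> k" and b: "1 < b"
    and a: "64 * real k \<le> b ^ e" "real (Suc e) \<le> 2 ^ a"
    and T0: "\<And>l. real (16 * a + 60) \<le> T0 l"
  shows "\<exists>H w' D. query_prog D = query_program \<and> oracle_fits 6 n D \<and>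
    interactive_emulator (4 * real k * b) G w H w' D T0 \<and>
    real (emulator_size H D) \<le> (21 + 2 * (ln (aspect_ratio G w) / ln b)) *
      (real k * real n powr (1 + 1 / real k))"
proof -
  define d where "d = rdist G w"
  interpret finite_metric "{..<n}" d
    using finite_metric_rdist[OF G(1,2)] by (simp add: d_def G(3))
  have "2 \<le> card (pverts G)" using n by (simp add: G(3))
  from aspect_ratio_bounds[OF G(1,2) this] obtain \<mu> M where \<mu>: "0 < \<mu>" "\<mu> \<le> M"
    and \<Lambda>: "aspect_ratio G w = M / \<mu>"
    and lower: "\<And>u v. u < n \<Longrightarrow> v < n \<Longrightarrow> u \<noteq> v \<Longrightarrow> \<mu> \<le> d u v"
    and upper: "\<And>u v. u < n \<Longrightarrow> v < n \<Longrightarrow> d u v \<le> M"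
    unfolding G(3) d_def by (metis lessThan_iff)
  have \<Lambda>1: "1 \<le> aspect_ratio G w" using \<mu> by (simp add: \<Lambda>)
  define S where "S = Suc (nat \<lceil>ln (aspect_ratio G w) / ln b\<rceil>)"
  \<comment> \<open>Dividing by \<open>b\<close> puts scale 0 below the minimum distance, which
    makes 0 a safe lower bound, and scale \<open>S\<close> still reaches the maximum.\<close>
  define r where "r i = \<mu> * b ^ i / b" for i :: nat
  have r0: "r 0 < \<mu>" using \<mu>(1) b by (simp add: r_def field_simps)
  have r_Suc: "r (Suc i) = b * r i" for i by (simp add: r_def)
  have r_pos: "0 < r i" for i using \<mu>(1) b by (simp add: r_def)
  have r_add: "r (i + i') = b ^ i' * r i" for i i' by (simp add: r_def power_add)
  have rS: "M \<le> r S"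
  proof -
    have "M = \<mu> * aspect_ratio G w" using \<mu>(1) by (simp add: \<Lambda>)
    also have "\<dots> \<le> \<mu> * b ^ nat \<lceil>ln (aspect_ratio G w) / ln b\<rceil>"
      using log_scales(1)[OF b \<Lambda>1] \<mu>(1) by (intro mult_left_mono) auto
    also have "\<dots> = r S" using b by (simp add: r_def S_def)
    finally show ?thesis .
  qed
  have S: "1 \<le> S" "real S \<le> ln (aspect_ratio G w) / ln b + 2"
    using log_scales(2)[OF b \<Lambda>1] by (auto simp: S_def)
  \<comment> \<open>The cap keeps \<open>R\<close> within the number of scales. When it is active,
    \<open>hi \<le> S\<close> makes \<open>hi - R\<close> equal to 0.\<close>
  define R where "R = min (Suc e) (Suc S)"
  obtain T xs s where T: "real T \<le> real (2 * k) * root (2 * k) n"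
    "(\<Sum>i<T. real (length (xs i))) \<le> root (2 * k) (real n) * n"
    "\<forall>i<T. distinct (xs i) \<and> set (xs i) \<subseteq> {..<n}"
    "\<forall>u\<in>{..<n}. s u < T \<and> (\<forall>i \<le> s u. u \<in> set (xs i))"
    "\<forall>u\<in>{..<n}. \<exists>U. u \<in> U \<and> ramsey_order (16 * real (2 * k)) (xs (s u)) U"
    using ramsey_orders_exist[of "2 * k"] k by auto
  have "\<exists>Tl lab sc. real Tl \<le> k * root k n \<and>
    (\<forall>j<Tl. \<forall>x\<in>{..<n}. lab j x \<in> {..<n} \<and> d x (lab j x) \<le> 2 * real k * r i) \<and>
    (\<forall>u\<in>{..<n}. sc u < (Tl::nat) \<and> (\<forall>v\<in>{..<n}. d u v \<le> r i \<longrightarrow> lab (sc u) v = lab (sc u) u))" for i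
    using covering_labels_exist[OF k, of "r i"] r_pos[of i] by simp
  then obtain Tl slab sc where L: "\<And>i. real (Tl i) \<le> k * root k n"
    "\<And>i j x. j < Tl i \<Longrightarrow> x < n \<Longrightarrow> slab i j x < n \<and> d x (slab i j x) \<le> 2 * real k * r i"
    "\<And>i u. u < n \<Longrightarrow> sc i u < Tl i"
    "\<And>i u v. u < n \<Longrightarrow> v < n \<Longrightarrow> d u v \<le> r i \<Longrightarrow> slab i (sc i u) v = slab i (sc i u) u"
    unfolding lessThan_iff Ball_def by metis
  define g where "g = Suc (floor_log n)"
  \<comment> \<open>The factor 2 lets the larger of two entries cover the sum of the distances to
    the midpoint. The index lies between 1 and \<open>S\<close> whatever its argument, so midpoints
    outside the order do no harm.\<close>
  define ent where "ent i p j = scale_index S r (2 * d (xs i ! p) (xs i ! midpoint j p))" for i p j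
  have ent_range: "1 \<le> ent i p j" "ent i p j \<le> S" for i p j
    using scale_index[OF S(1)] by (auto simp: ent_def)
  have ent_less: "ent i p j < n + Suc S" for i p j using ent_range(2)[of i p j] by simp
  have "n \<le> 2 ^ g" using floor_log_exp2_ge[of n] by (simp add: g_def)
  then interpret packed_layout n g "Suc S" R 1 T xs s ent Tl sc slab
    using n T(3,4) L(2,3) ent_less by unfold_locales (auto simp: R_def)
  define F where "F = (\<lambda>(i, j, x). (x, slab i j x)) `
    (SIGMA i:{..<Suc S}. {..<Tl i} \<times> {..<n})"
  define B where "B = real k * real n powr (1 + 1 / real k)"
  have "card F \<le> (\<Sum>i<Suc S. Tl i * n)"
    unfolding F_def by (rule order_trans[OF card_image_le]) (auto simp: card_SigmaI)
  then have "real (card F) \<le> real (\<Sum>i<Suc S. Tl i * n)" by (rule of_nat_mono)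
  also have "\<dots> = (\<Sum>i<Suc S. real (Tl i) * n)" by (simp only: of_nat_sum of_nat_mult)
  also have "\<dots> \<le> (\<Sum>i<Suc S. (k * root k n) * n)"
    using L(1) by (intro sum_mono mult_right_mono) auto
  also have "\<dots> = real (Suc S) * B" by (simp add: B_def root_times[OF k n(1), symmetric])
  finally have cF: "real (card F) \<le> real (Suc S) * B" .
  have fF: "finite F" unfolding F_def by auto
  have "interactive_emulator (4 * real k * b) G w (metric_graph {..<n} F) (\<lambda>(x, y). d x y) packed T0"
    unfolding d_def G(3)[symmetric]
  proof (rule interactive_emulatorI[OF G(1,2), where b = "real (16 * a + 60)"])
    show "real (16 * a + 60) \<le> T0 l" for l by (rule T0)
    show "\<exists>t. answers_in packed u u [u] t \<and> real t \<le> real (16 * a + 60)" for u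
      using answer_same_packed[of u] by (intro exI[of _ 4]) simp
    fix u v assume "u \<in> pverts G" "v \<in> pverts G" and uv: "u \<noteq> v"
    then have u: "u < n" and v: "v < n" by (auto simp: G(3))
    define i where "i = min (s u) (s v)"
    define p where "p = position i u"
    define q where "q = position i v"
    define j where "j = floor_log (Bit_Operations.xor p q)"
    note E = entry_lookup_packed[OF u v uv i_def p_def q_def j_def]
    have "s u = i \<or> s v = i" by (auto simp: i_def min_def)
    then obtain U where U: "u \<in> U \<or> v \<in> U" "ramsey_order (16 * real (2 * k)) (xs i) U"
      using T(5) u v by blast
    have V: "set (xs i) \<subseteq> {..<n}" using T(3) E(2) by blast
    note P = ramsey_midpoint[OF U(2,1) V E(3,5,4,6,7) j_def]
    define z where "z = xs i ! midpoint j p"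
    have z: "z < n" using V P(2) by (auto simp: z_def subset_iff)
    have uz: "ent i p j = scale_index S r (2 * d u z)" and vz: "ent i q j = scale_index S r (2 * d v z)"
      using P(1) E(5,6) by (simp_all add: ent_def z_def)
    have dz: "d u z \<le> 32 * real k * d u v" "d v z \<le> 32 * real k * d u v"
      using P(3,4) d_sym[of z v] z v by (simp_all add: z_def)
    define hi where "hi = max (ent i p j) (ent i q j)"
    have hi: "0 < hi" "hi < Suc S" using ent_range(1)[of i p j] ent_range(2)[of i p j] ent_range(2)[of i q j] by (auto simp: hi_def)
    have r_mono: "r i \<le> r i'" if "i \<le> i'" for i i'
      using that b \<mu>(1) by (simp add: r_def divide_right_mono power_increasing)
    have hi_covers: "d u v \<le> r hi"
    proof (cases "hi = S")
      case True
      then show ?thesis using rS upper[OF u v] by simp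
    next
      case False
      then have "ent i p j \<noteq> S" "ent i q j \<noteq> S"
        using ent_range(2)[of i p j] ent_range(2)[of i q j] by (auto simp: hi_def max_def)
      then have "2 * d u z \<le> r (ent i p j)" "2 * d v z \<le> r (ent i q j)"
        using scale_index(3)[OF S(1)] unfolding uz vz by blast+
      then have "2 * d u z \<le> r hi" "2 * d v z \<le> r hi"
        using r_mono[of "ent i p j" hi] r_mono[of "ent i q j" hi] by (auto simp: hi_def)
      then have "d u z + d z v \<le> r hi" using d_sym[of z v] z v by simp
      then show ?thesis using d_triangle[of u z v] u v z by simp
    qed
    have duv: "0 < d u v" "\<mu> \<le> d u v" using d_pos u v uv lower by auto
    \<comment> \<open>By minimality of the larger entry, scale \<open>hi - 1\<close> is below twice
      a distance to \<open>z\<close>, hence below \<open>64 * k * d u v\<close>; going down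
      \<open>e\<close> further scales divides by \<open>b ^ e\<close>.\<close>
    have lo: "r (hi - R) < d u v"
    proof (cases "hi \<le> R")
      case True
      then show ?thesis using r0 duv by simp
    next
      case False
      then have R: "R = Suc e" "Suc e < hi" using hi by (auto simp: R_def)
      then have "r (hi - 1) < 2 * d u z \<or> r (hi - 1) < 2 * d v z"
        using scale_index(4)[OF S(1), of "hi - 1" r "2 * d u z"]
          scale_index(4)[OF S(1), of "hi - 1" r "2 * d v z"] uz vz hi(1)
        by (auto simp: hi_def max_def split: if_splits)
      then have "r (hi - 1) < 64 * real k * d u v" using dz by linarith
      also have "\<dots> \<le> b ^ e * d u v" using a(1) duv by (intro mult_right_mono) auto
      finally have "r (hi - 1) < b ^ e * d u v" .
      moreover have "r (hi - 1) = b ^ e * r (hi - R)"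
        using r_add[of "hi - R" e] R by simp
      moreover have "0 < b ^ e" using b by simp
      ultimately show ?thesis by simp
    qed
    have test_hi: "slab hi (sc hi u) u = slab hi (sc hi u) v"
      using L(4)[OF u v hi_covers] by simp
    have Ra: "0 < R" "R \<le> 2 ^ a"
    proof -
      have "Suc e \<le> 2 ^ a" using a(2) by (metis of_nat_le_iff of_nat_numeral of_nat_power)
      then show "0 < R" "R \<le> 2 ^ a" by (auto simp: R_def)
    qed
    from answer_by_search_packed[OF u v uv i_def p_def q_def j_def refl hi_def hi Ra test_hi]
    obtain t h where t: "t \<le> 16 * a + 60" "hi - R < h" "h \<le> hi" "slab h (sc h u) u = slab h (sc h u) v"
      "h = Suc (hi - R) \<or> slab (h - 1) (sc (h - 1) u) u \<noteq> slab (h - 1) (sc (h - 1) u) v"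
      "answers_in packed u v (via u (slab h (sc h u) u) v) t" by blast
    define c where "c = slab h (sc h u) u"
    have c: "c < n" "d u c \<le> 2 * real k * r h" "d v c \<le> 2 * real k * r h"
      using L(2)[OF L(3)[OF u] u, of h] L(2)[OF L(3)[OF u] v, of h] t(4) by (simp_all add: c_def)
    \<comment> \<open>If the test failed at \<open>h - 1\<close>, then \<open>v\<close> lies outside
      the monochromatic ball of \<open>u\<close> at that scale.\<close>
    have "r (h - 1) < d u v"
    proof (cases "h = Suc (hi - R)")
      case True
      then show ?thesis using lo by simp
    next
      case False
      then show ?thesis using t(5) L(4)[OF u v, of "h - 1"] by force
    qed
    then have "b * r (h - 1) \<le> b * d u v" using b by simp
    moreover have "r h = b * r (h - 1)" using r_Suc[of "h - 1"] t(2) by simp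
    ultimately have rh: "r h \<le> b * d u v" by simp
    \<comment> \<open>As \<open>c\<close> is the label of both vertices, each hop is at most
      \<open>2 * k * r h\<close>.\<close>
    have "d u c + d c v \<le> 4 * real k * r h" using c d_sym[of c v] v by simp
    also have "\<dots> \<le> 4 * real k * (b * d u v)" using rh by (intro mult_left_mono) auto
    finally have "d u c + d c v \<le> 4 * real k * b * d u v" by (simp add: mult.assoc)
    moreover have hS: "h < Suc S" using t(3) hi(2) by simp
    have "(u, c) \<in> F"
      unfolding F_def c_def using L(3)[OF u, of h] u hS by (intro image_eqI[of _ _ "(h, sc h u, u)"]) auto
    moreover have "(v, c) \<in> F"
      unfolding F_def c_def using L(3)[OF u, of h] v hS t(4)
      by (intro image_eqI[of _ _ "(h, sc h u, v)"]) auto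
    ultimately show "\<exists>c\<in>pverts G. (c = u \<or> (u, c) \<in> F \<or> (c, u) \<in> F) \<and>
      (c = v \<or> (v, c) \<in> F \<or> (c, v) \<in> F) \<and>
      rdist G w u c + rdist G w c v \<le> 4 * real k * b * rdist G w u v \<and>
      (\<exists>t. answers_in packed u v (via u c v) t \<and> real t \<le> real (16 * a + 60))"
      using t(1,6) c(1) unfolding c_def[symmetric] d_def G(3)
      by (intro bexI[of _ c] conjI exI[of _ t]) (auto simp del: of_nat_add of_nat_mult)
  qed
  moreover have "real (emulator_size (metric_graph {..<n} F) packed) \<le>
      (21 + 2 * (ln (aspect_ratio G w) / ln b)) * B"
  proof -
    have B: "0 \<le> B" by (simp add: B_def)
    have "real (length data) \<le> (15 + 2 * real (Suc S)) * B"
      unfolding B_def using T(1,2) L(1) by (intro length_data_le[OF k g_def]) auto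
    moreover have "real (card (edge_set (metric_graph {..<n} F))) \<le> real (card F)"
      using card_edge_set_metric_graph[OF fF] by simp
    moreover have "real (Suc S) * B \<le> (15 + 2 * real (Suc S)) * B"
      using B by (intro mult_right_mono) auto
    \<comment> \<open>There are \<open>Suc S\<close> scales and \<open>S\<close> exceeds the
      logarithmic ratio by at most 2; 21 is \<open>15 + 2 * 3\<close>.\<close>
    moreover have "(15 + 2 * real (Suc S)) * B \<le> (21 + 2 * (ln (aspect_ratio G w) / ln b)) * B"
      using B S(2) by (intro mult_right_mono) auto
    ultimately show ?thesis
      using cF unfolding emulator_size_def packed_def by (simp add: max_def)
  qed
  moreover have "query_prog packed = query_program" unfolding packed_def by simp
  ultimately show ?thesis using oracle_fits_packed unfolding B_def by blast
qed

section \<open>Parameter choice and the final constants\<close>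

lemma oracle_fits_mono: "oracle_fits C n D \<Longrightarrow> C \<le> C' \<Longrightarrow> oracle_fits C' n D"
  unfolding oracle_fits_def by (auto intro: order_trans mult_right_mono)

text \<open>Apply \<open>ln y \<le> y - 1\<close> to \<open>y = 1 / (1 + x)\<close>. The limit 15 is
  \<open>\<epsilon> / 4\<close> at \<open>\<epsilon> = 60\<close>.\<close>

lemma ln_one_plus_ge:
  assumes "0 < x" "x \<le> (15::real)"
  shows "x / 16 \<le> ln (1 + x)"
proof -
  have "ln (inverse (1 + x)) \<le> inverse (1 + x) - 1" using assms by (intro ln_le_minus_one) simp
  then have "1 - inverse (1 + x) \<le> ln (1 + x)" using assms by (simp add: ln_inverse)
  moreover have "x / 16 \<le> x / (1 + x)" using assms by (intro divide_left_mono) auto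
  moreover have "x / (1 + x) = 1 - inverse (1 + x)" using assms by (simp add: field_simps)
  ultimately show ?thesis by simp
qed

text \<open>The window has \<open>O((1 + ln k) / \<epsilon>)\<close> scales, and the logarithm of
  this product splits into the two terms of the query time.\<close>

lemma search_time_bound:
  fixes \<epsilon> :: real
  assumes k: "1 \<le> k" and \<epsilon>: "0 < \<epsilon>" "\<epsilon> \<le> 60" and b: "b = 1 + \<epsilon> / 4"
  shows "\<exists>e a. 64 * real k \<le> b ^ e \<and> real (Suc e) \<le> 2 ^ a \<and>
    real (16 * a + 60) \<le> 200000 * (1 + ln (1 + ln (real k)) + ln (1 + 1 / \<epsilon>))"
proof -
  have lnb: "\<epsilon> / 64 \<le> ln b" using ln_one_plus_ge[of "\<epsilon> / 4"] \<epsilon> by (simp add: b)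
  define e where "e = nat \<lceil>ln (64 * real k) / ln b\<rceil>"
  have e: "64 * real k \<le> b ^ e" "real e \<le> ln (64 * real k) / ln b + 1"
    using log_scales[of b "64 * real k"] k \<epsilon> by (auto simp: e_def b)
  define a where "a = nat \<lceil>ln (real (Suc e)) / ln 2\<rceil>"
  have a: "real (Suc e) \<le> 2 ^ a" "real a \<le> ln (real (Suc e)) / ln 2 + 1"
    using log_scales[of 2 "real (Suc e)"] by (simp_all add: a_def)
  have lnk: "0 \<le> ln (real k)" using k by simp
  \<comment> \<open>The crude \<open>ln x \<le> x - 1\<close> supplies the constants: 63 for
    \<open>ln 64\<close>, then \<open>4032 = 63 * 64\<close>, and 4033 for
    \<open>ln 4034\<close>.\<close>
  have "ln (64 * real k) = ln 64 + ln (real k)" using k by (simp add: ln_mult)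
  also have "\<dots> \<le> 63 * (1 + ln (real k))" using ln_le_minus_one[of 64] lnk by simp
  finally have "ln (64 * real k) / ln b \<le> (63 * (1 + ln (real k))) / (\<epsilon> / 64)"
    using lnb \<epsilon> lnk by (intro frac_le) auto
  then have "real (Suc e) \<le> 4032 * ((1 + ln (real k)) * (1 / \<epsilon>)) + 2"
    using e(2) by simp
  also have "\<dots> \<le> 4034 * ((1 + ln (real k)) * (1 + 1 / \<epsilon>))"
  proof -
    have "1 * 1 \<le> (1 + ln (real k)) * (1 + 1 / \<epsilon>)" using lnk \<epsilon> by (intro mult_mono) auto
    moreover have "(1 + ln (real k)) * (1 / \<epsilon>) \<le> (1 + ln (real k)) * (1 + 1 / \<epsilon>)"
      using lnk by (intro mult_left_mono) auto
    ultimately show ?thesis by linarith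
  qed
  finally have "ln (real (Suc e)) \<le> ln (4034 * ((1 + ln (real k)) * (1 + 1 / \<epsilon>)))"
    by (subst ln_le_cancel_iff) (use lnk \<epsilon> in \<open>auto intro!: mult_pos_pos add_pos_nonneg add_pos_pos\<close>)
  also have "\<dots> = ln 4034 + (ln (1 + ln (real k)) + ln (1 + 1 / \<epsilon>))"
  proof -
    have "0 < 1 + ln (real k)" "0 < 1 + 1 / \<epsilon>" using lnk \<epsilon> by (auto intro: add_pos_pos)
    then show ?thesis by (simp only: ln_mult_pos mult_pos_pos zero_less_numeral)
  qed
  also have "\<dots> \<le> 4033 + (ln (1 + ln (real k)) + ln (1 + 1 / \<epsilon>))"
    using ln_le_minus_one[of 4034] by simp
  finally have lne: "ln (real (Suc e)) \<le> 4033 + (ln (1 + ln (real k)) + ln (1 + 1 / \<epsilon>))" .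
  have "ln (real (Suc e)) / ln 2 \<le> ln (real (Suc e)) / (1 / 2)"
    using ln_2_ge_half by (intro divide_left_mono) auto
  then have "real a \<le> 2 * ln (real (Suc e)) + 1" using a(2) by simp
  moreover have "0 \<le> ln (1 + ln (real k))" "0 \<le> ln (1 + 1 / \<epsilon>)" using lnk \<epsilon> by auto
  ultimately have "real (16 * a + 60) \<le> 200000 * (1 + ln (1 + ln (real k)) + ln (1 + 1 / \<epsilon>))"
    using lne by simp
  with e(1) a(1) show ?thesis by blast
qed

lemma interactive_emulator_exists:
  fixes G :: "nat pair_pre_digraph" and \<epsilon> :: real
  assumes G: "weighted_graph G w" "pverts G = {..<n}" "connected (with_proj G)"
    and k: "1 \<le> k" and \<epsilon>: "0 < \<epsilon>"
  shows "\<exists>H w' D. query_prog D = query_program \<and> oracle_fits 200000 n D \<and>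
    interactive_emulator ((4 + \<epsilon>) * real k) G w H w' D
      (\<lambda>l. 200000 * ((1 + ln (1 + ln (real k)) + ln (1 + 1 / \<epsilon>)) + real l)) \<and>
    real (emulator_size H D) \<le>
      200000 * (real k * (1 + ln (aspect_ratio G w) / \<epsilon>) * real n powr (1 + 1 / real k))"
proof -
  let ?T = "\<lambda>l. 200000 * ((1 + ln (1 + ln (real k)) + ln (1 + 1 / \<epsilon>)) + real l)"
  define B where "B = real k * real n powr (1 + 1 / real k)"
  have B: "0 \<le> B" by (simp add: B_def)
  have "pverts G \<noteq> {}" using G(3) by (auto simp: connected_def strongly_connected_def)
  then have n0: "0 < n" using G(2) by auto
  \<comment> \<open>On a single vertex the ratio is 1 by convention, so its logarithm is 0.\<close>
  have \<Lambda>: "0 \<le> ln (aspect_ratio G w)"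
  proof (cases "2 \<le> card (pverts G)")
    case True
    from aspect_ratio_bounds[OF G(1,3) this] obtain m M :: real
      where "0 < m" "m \<le> M" "aspect_ratio G w = M / m" by metis
    then show ?thesis by simp
  qed (simp add: aspect_ratio_def)
  obtain H w' D where HD: "query_prog D = query_program" "oracle_fits 6 n D"
    "interactive_emulator ((4 + \<epsilon>) * real k) G w H w' D ?T"
    "real (emulator_size H D) \<le> (21 + 128 * (ln (aspect_ratio G w) / \<epsilon>)) * B"
  \<comment> \<open>Beyond 60 the stretch \<open>4 + \<epsilon>\<close> exceeds 64 and the direct
    construction applies. Up to 60, \<open>ln b\<close> is at least
    \<open>\<epsilon> / 64\<close>.\<close>
  proof (cases "2 \<le> n \<and> \<epsilon> \<le> 60")
    case True
    define b where "b = 1 + \<epsilon> / 4"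
    have b1: "1 < b" using \<epsilon> by (simp add: b_def)
    obtain e a where ea: "64 * real k \<le> b ^ e" "real (Suc e) \<le> 2 ^ a"
      "real (16 * a + 60) \<le> 200000 * (1 + ln (1 + ln (real k)) + ln (1 + 1 / \<epsilon>))"
      using search_time_bound[OF k \<epsilon> _ b_def] True by blast
    have "real (16 * a + 60) \<le> ?T l" for l using ea(3) by simp
    from search_emulator[OF G(1,3,2) _ k b1 ea(1,2), of ?T, OF _ this] True
    obtain H w' D where H: "query_prog D = query_program" "oracle_fits 6 n D"
      "interactive_emulator (4 * real k * b) G w H w' D ?T"
      "real (emulator_size H D) \<le> (21 + 2 * (ln (aspect_ratio G w) / ln b)) * B"
      unfolding B_def by auto
    have "\<epsilon> / 64 \<le> ln b" using ln_one_plus_ge[of "\<epsilon> / 4"] \<epsilon> True by (simp add: b_def)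
    then have "ln (aspect_ratio G w) / ln b \<le> ln (aspect_ratio G w) / (\<epsilon> / 64)"
      using \<Lambda> \<epsilon> by (intro divide_left_mono) auto
    then have size: "(21 + 2 * (ln (aspect_ratio G w) / ln b)) * B \<le>
        (21 + 128 * (ln (aspect_ratio G w) / \<epsilon>)) * B"
      using B by (intro mult_right_mono) auto
    have stretch: "4 * real k * b = (4 + \<epsilon>) * real k" by (simp add: b_def field_simps)
    show ?thesis
      by (rule that[OF H(1,2) H(3)[unfolded stretch] order_trans[OF H(4) size]])
  next
    case False
    have "64 * real k \<le> (4 + \<epsilon>) * real k \<or> n = 1"
      using False n0 by (auto intro: mult_right_mono)
    moreover have "40 \<le> ?T l" for l
    proof -
      have "0 \<le> ln (1 + ln (real k))" "0 \<le> ln (1 + 1 / \<epsilon>)" using k \<epsilon> by auto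
      then show ?thesis by simp
    qed
    ultimately obtain H w' D where H: "query_prog D = query_program" "oracle_fits 6 n D"
      "interactive_emulator ((4 + \<epsilon>) * real k) G w H w' D ?T" "real (emulator_size H D) \<le> 15 * B"
      using direct_emulator[OF G(1,3,2) n0 k, of "(4 + \<epsilon>) * real k" ?T] unfolding B_def by blast
    have size: "15 * B \<le> (21 + 128 * (ln (aspect_ratio G w) / \<epsilon>)) * B"
      using B \<Lambda> \<epsilon> by (intro mult_right_mono) auto
    show ?thesis by (rule that[OF H(1-3) order_trans[OF H(4) size]])
  qed
  have "(21 + 128 * (ln (aspect_ratio G w) / \<epsilon>)) * B \<le>
      200000 * (real k * (1 + ln (aspect_ratio G w) / \<epsilon>) * real n powr (1 + 1 / real k))"
  proof -
    have "0 \<le> ln (aspect_ratio G w) / \<epsilon>" using \<Lambda> \<epsilon> by simp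
    then have "(21 + 128 * (ln (aspect_ratio G w) / \<epsilon>)) * B \<le>
        (200000 * (1 + ln (aspect_ratio G w) / \<epsilon>)) * B"
      using B by (intro mult_right_mono) auto
    then show ?thesis by (simp add: B_def algebra_simps)
  qed
  then have "real (emulator_size H D) \<le>
      200000 * (real k * (1 + ln (aspect_ratio G w) / \<epsilon>) * real n powr (1 + 1 / real k))"
    using HD(4) by linarith
  moreover have "oracle_fits 200000 n D" using HD(2) by (rule oracle_fits_mono) simp
  ultimately show ?thesis using HD(1,3) by blast
qed

theorem theorem11:
  shows "\<exists>(P :: program) (C :: real). \<forall>(G :: nat pair_pre_digraph) w (n :: nat) (k :: nat) (\<epsilon> :: real).
    weighted_graph G w \<and> pverts G = {..<n} \<and> connected (with_proj G) \<and> 1 \<le> k \<and> 0 < \<epsilon> \<longrightarrow>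
    (\<exists>H w' D.
       query_prog D = P \<and> oracle_fits C n D \<and>
       interactive_emulator ((4 + \<epsilon>) * real k) G w H w' D
         (\<lambda>l. C * ((1 + ln (1 + ln (real k)) + ln (1 + 1 / \<epsilon>)) + real l)) \<and>
       real (emulator_size H D) \<le>
         C * (real k * (1 + ln (aspect_ratio G w) / \<epsilon>) * real n powr (1 + 1 / real k)))"
\<comment> \<open>The query time dictates the constant; the word size factor 6 and the size
  coefficients 21 and 128 lie far below it.\<close>
proof (intro exI[of _ query_program] exI[of _ 200000] allI impI, elim conjE)
  fix G :: "nat pair_pre_digraph" and w and n k :: nat and \<epsilon> :: real
  assume "weighted_graph G w" "pverts G = {..<n}" "connected (with_proj G)" "1 \<le> k" "0 < \<epsilon>"
  then show "\<exists>H w' D.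
       query_prog D = query_program \<and> oracle_fits 200000 n D \<and>
       interactive_emulator ((4 + \<epsilon>) * real k) G w H w' D
         (\<lambda>l. 200000 * ((1 + ln (1 + ln (real k)) + ln (1 + 1 / \<epsilon>)) + real l)) \<and>
       real (emulator_size H D) \<le>
         200000 * (real k * (1 + ln (aspect_ratio G w) / \<epsilon>) * real n powr (1 + 1 / real k))"
    by (rule interactive_emulator_exists)
qed

end
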